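(* For every left-invariant positive-definite symmetric $(0,2)$-tensor field $Y$ on $SU(2)$, there exists a unique left-invariant Riemannian metric $g$ on $SU(2)$ such that $X(g)=Y$. Moreover, $$\lambda(g)\le\lambda(Y),$$ with equality holding if and only if $g=\rho g_0$ for some $\rho>0$.
   Context: $g_0$ is the bi-invariant metric on $SU(2)$ with $g_0(A,B)=-2\,\mathrm{tr}(AB)$ for $A,B\in\mathfrak{su}(2)$. For a left-invariant metric (positive-definite symmetric $(0,2)$-tensor field) $g$ on $SU(2)$, $$\lambda(g)=\sup\Big\{\frac{g(A,A)}{g(B,B)}\,\Big|\,A,B\in\mathfrak{su}(2),\ g_0(A,A)=g_0(B,B)=1\Big\},$$ i.e. the ratio of the largest to the smallest eigenvalue of the matrix of $g$ in a $g_0$-orthonormal basis of $\mathfrak{su}(2)$. For a Riemannian metric $g$, let $\mathrm{Ric}(g)$ and $S(g)$ denote the Ricci and scalar curvature, and let $\mathcal E(g)$ be the field of endomorphisms with $g(\mathcal E(g)u,v)=\mathrm{Ric}(g)(u,v)-\tfrac12S(g)g(u,v)$. When $\mathcal E(g)$ is invertible, the cross curvature $(0,2)$-tensor is $X(g)(u,v)=\det(\mathcal E(g))\,g(\mathcal E(g)^{-1}u,v)$. The equation $X(g)=Y$ includes the requirement that $\mathcal E(g)$ be invertible. *)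

theory Defs
  imports "HOL-Analysis.Analysis"
begin

section \<open>The group SU(2) as a submanifold of the complex matrices\<close>

type_synonym mat2 = "complex^2^2"

definition ctranspose :: "mat2 \<Rightarrow> mat2" where
  "ctranspose U = (\<chi> i j. cnj (U $ j $ i))"

definition SU2 :: "mat2 set" where
  "SU2 = {U. U ** ctranspose U = mat 1 \<and> det U = 1}"

definition su2 :: "mat2 set" where
  "su2 = {A. ctranspose A = - A \<and> trace A = 0}"

definition tangent :: "mat2 \<Rightarrow> mat2 set" where
  "tangent p = (\<lambda>A. p ** A) ` su2"

section \<open>Left-invariant (0,2)-tensor fields\<close>

type_synonym tensor02 = "mat2 \<Rightarrow> mat2 \<Rightarrow> mat2 \<Rightarrow> real"

text \<open>A tensor field \<open>h\<close> assigns to a point \<open>p\<close> the form \<open>h p\<close> on \<open>tangent p\<close>. Values outside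
  the tangent bundle are normalised to 0, so that HOL equality is equality of tensor fields.\<close>

definition tensor_field :: "tensor02 \<Rightarrow> bool" where
  "tensor_field h \<longleftrightarrow>
     (\<forall>p\<in>SU2. \<forall>u\<in>tangent p. \<forall>u'\<in>tangent p. \<forall>v\<in>tangent p. \<forall>a b.
        h p (a *\<^sub>R u + b *\<^sub>R u') v = a * h p u v + b * h p u' v \<and>
        h p v (a *\<^sub>R u + b *\<^sub>R u') = a * h p v u + b * h p v u') \<and>
     (\<forall>p u v. \<not> (p \<in> SU2 \<and> u \<in> tangent p \<and> v \<in> tangent p) \<longrightarrow> h p u v = 0)"

definition sym_pos_def :: "tensor02 \<Rightarrow> bool" where
  "sym_pos_def h \<longleftrightarrow>
     (\<forall>p\<in>SU2. \<forall>u\<in>tangent p. \<forall>v\<in>tangent p. h p u v = h p v u) \<and>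
     (\<forall>p\<in>SU2. \<forall>u\<in>tangent p. u \<noteq> 0 \<longrightarrow> h p u u > 0)"

definition left_invariant :: "tensor02 \<Rightarrow> bool" where
  "left_invariant h \<longleftrightarrow>
     (\<forall>q\<in>SU2. \<forall>p\<in>SU2. \<forall>u\<in>tangent p. \<forall>v\<in>tangent p. h (q ** p) (q ** u) (q ** v) = h p u v)"

text \<open>Smoothness is not required separately: a left-invariant tensor field has constant
  coefficients in a left-invariant frame, hence is smooth.\<close>

definition left_invariant_metric :: "tensor02 \<Rightarrow> bool" where
  "left_invariant_metric h \<longleftrightarrow> tensor_field h \<and> sym_pos_def h \<and> left_invariant h"

text \<open>The bi-invariant metric given by \<open>- 2 tr (A B)\<close> on \<open>su2\<close>. The trace is real there, so
  \<open>Re\<close> only adjusts the type.\<close>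

definition g0 :: tensor02 where
  "g0 p u v =
     (if p \<in> SU2 \<and> u \<in> tangent p \<and> v \<in> tangent p
      then - 2 * Re (trace ((matrix_inv p ** u) ** (matrix_inv p ** v))) else 0)"

definition eigenvalue_ratio :: "tensor02 \<Rightarrow> real" where
  "eigenvalue_ratio g =
     Sup {g (mat 1) A A / g (mat 1) B B | A B.
            A \<in> su2 \<and> B \<in> su2 \<and> g0 (mat 1) A A = 1 \<and> g0 (mat 1) B B = 1}"

section \<open>Trace and determinant of endomorphisms of a tangent space\<close>

definition su2_basis :: "3 \<Rightarrow> mat2" where
  "su2_basis k =
     (if k = 1 then vector [vector [0, \<i> / 2], vector [\<i> / 2, 0]]
      else if k = 2 then vector [vector [0, 1 / 2], vector [- 1 / 2, 0]]
      else vector [vector [\<i> / 2, 0], vector [0, - \<i> / 2]])"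

text \<open>Matrix of an endomorphism \<open>L\<close> of \<open>tangent p\<close> in the basis \<open>p ** su2_basis k\<close>. As this basis
  is \<open>g0\<close>-orthonormal, \<open>g0\<close> reads off coordinates. Trace and determinant of this matrix are
  those of \<open>L\<close>, independently of the basis and of any metric.\<close>

definition endo_matrix :: "mat2 \<Rightarrow> (mat2 \<Rightarrow> mat2) \<Rightarrow> real^3^3" where
  "endo_matrix p L = (\<chi> i j. g0 p (L (p ** su2_basis j)) (p ** su2_basis i))"

section \<open>Levi-Civita connection and curvature\<close>

text \<open>Vector fields are functions \<open>X :: mat2 \<Rightarrow> mat2\<close> with \<open>X p \<in> tangent p\<close> for \<open>p \<in> SU2\<close>; only
  their restriction to \<open>SU2\<close> matters. The derivative within \<open>SU2\<close> is determined in tangent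
  directions \<open>v \<in> tangent p\<close>, and only these are used.\<close>

definition dir_deriv :: "(mat2 \<Rightarrow> 'b::real_normed_vector) \<Rightarrow> mat2 \<Rightarrow> mat2 \<Rightarrow> 'b" where
  "dir_deriv F p v = frechet_derivative F (at p within SU2) v"

definition lie_bracket :: "(mat2 \<Rightarrow> mat2) \<Rightarrow> (mat2 \<Rightarrow> mat2) \<Rightarrow> mat2 \<Rightarrow> mat2" where
  "lie_bracket X Y p = dir_deriv Y p (X p) - dir_deriv X p (Y p)"

definition koszul :: "tensor02 \<Rightarrow> (mat2 \<Rightarrow> mat2) \<Rightarrow> (mat2 \<Rightarrow> mat2) \<Rightarrow> (mat2 \<Rightarrow> mat2) \<Rightarrow> mat2 \<Rightarrow> real"
  where
  "koszul g X Y Z p =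
     dir_deriv (\<lambda>q. g q (Y q) (Z q)) p (X p)
     + dir_deriv (\<lambda>q. g q (X q) (Z q)) p (Y p)
     - dir_deriv (\<lambda>q. g q (X q) (Y q)) p (Z p)
     + g p (lie_bracket X Y p) (Z p)
     - g p (lie_bracket X Z p) (Y p)
     - g p (lie_bracket Y Z p) (X p)"

text \<open>The vector field \<open>\<nabla>\<^sub>X Y\<close> of the Levi-Civita connection. The Koszul formula is tensorial in the
  third argument and the left-invariant fields \<open>q \<mapsto> q ** C\<close> span every tangent space, so
  it suffices to test against these.\<close>

definition levi_civita :: "tensor02 \<Rightarrow> (mat2 \<Rightarrow> mat2) \<Rightarrow> (mat2 \<Rightarrow> mat2) \<Rightarrow> mat2 \<Rightarrow> mat2" where
  "levi_civita g X Y p =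
     (THE w. w \<in> tangent p \<and>
        (\<forall>C\<in>su2. 2 * g p w (p ** C) = koszul g X Y (\<lambda>q. q ** C) p))"

definition riemann ::
  "tensor02 \<Rightarrow> (mat2 \<Rightarrow> mat2) \<Rightarrow> (mat2 \<Rightarrow> mat2) \<Rightarrow> (mat2 \<Rightarrow> mat2) \<Rightarrow> mat2 \<Rightarrow> mat2" where
  "riemann g X Y Z p =
     levi_civita g X (levi_civita g Y Z) p
     - levi_civita g Y (levi_civita g X Z) p
     - levi_civita g (lie_bracket X Y) Z p"

text \<open>The left-invariant vector field with value \<open>u\<close> at \<open>p\<close>.\<close>

definition left_extension :: "mat2 \<Rightarrow> mat2 \<Rightarrow> mat2 \<Rightarrow> mat2" where
  "left_extension p u = (\<lambda>q. q ** (matrix_inv p ** u))"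

text \<open>\<open>Ric (u, v)\<close> is the trace of \<open>w \<mapsto> R (w, u) v\<close>. The curvature is tensorial, so tangent
  vectors may be extended to any vector fields.\<close>

definition ricci :: "tensor02 \<Rightarrow> tensor02" where
  "ricci g p u v =
     trace (endo_matrix p (\<lambda>w.
       riemann g (left_extension p w) (left_extension p u) (left_extension p v) p))"

text \<open>The field of endomorphisms \<open>L\<close> with \<open>g (L u, v) = h (u, v)\<close>.\<close>

definition raise_index :: "tensor02 \<Rightarrow> tensor02 \<Rightarrow> mat2 \<Rightarrow> mat2 \<Rightarrow> mat2" where
  "raise_index g h p u = (THE w. w \<in> tangent p \<and> (\<forall>v\<in>tangent p. g p w v = h p u v))"

definition scalar_curvature :: "tensor02 \<Rightarrow> mat2 \<Rightarrow> real" where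
  "scalar_curvature g p = trace (endo_matrix p (raise_index g (ricci g) p))"

section \<open>Cross curvature\<close>

definition einstein_endo :: "tensor02 \<Rightarrow> mat2 \<Rightarrow> mat2 \<Rightarrow> mat2" where
  "einstein_endo g =
     raise_index g (\<lambda>p u v. ricci g p u v - 1 / 2 * scalar_curvature g p * g p u v)"

definition cross_curvature :: "tensor02 \<Rightarrow> tensor02" where
  "cross_curvature g p u v =
     det (endo_matrix p (einstein_endo g p)) *
     g p (inv_into (tangent p) (einstein_endo g p) u) v"

definition has_cross_curvature :: "tensor02 \<Rightarrow> tensor02 \<Rightarrow> bool" where
  "has_cross_curvature g Y \<longleftrightarrow>
     (\<forall>p\<in>SU2. bij_betw (einstein_endo g p) (tangent p) (tangent p)) \<and>
     (\<forall>p\<in>SU2. \<forall>u\<in>tangent p. \<forall>v\<in>tangent p. cross_curvature g p u v = Y p u v)"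

end

theory Submission
  imports Defs
begin

text \<open>
  The Lie algebra with the bi-invariant inner product is Euclidean three-space, its bracket being the
  negative cross product. A left-invariant metric is an inner product on it, and some rotated frame
  diagonalises that inner product (\<open>framed_metric_exists\<close>); let \<open>a, b, c\<close> be its eigenvalues. The Koszul
  formula makes the connection explicit in such a frame, and the Einstein endomorphism comes out
  diagonal with entries \<open>-k\<^sub>1, -k\<^sub>2, -k\<^sub>3\<close>, where \<open>k\<^sub>i\<close> is the sectional curvature of the plane spanned by
  the other two frame vectors. The cross curvature is therefore diagonal in the same frame, with
  eigenvalues \<open>a k\<^sub>2 k\<^sub>3\<close>, \<open>b k\<^sub>3 k\<^sub>1\<close>, \<open>c k\<^sub>1 k\<^sub>2\<close> (\<open>has_cross_curvature_iff\<close>), and the geometric problem becomes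
  the problem of solving these three equations for positive \<open>a, b, c\<close>.

  The equations separate in the variables \<open>x\<^sub>i = k\<^sub>i / (k\<^sub>1 + k\<^sub>2 + k\<^sub>3)\<close>. When the cross curvature is
  positive, all \<open>k\<^sub>i\<close> are positive, so the \<open>x\<^sub>i\<close> are positive with sum 1; the metric eigenvalues are
  proportional to \<open>1 - x\<^sub>i\<^sup>2\<close> and the cross curvature eigenvalues are proportional to
  \<open>(1 - x\<^sub>i\<^sup>2) / x\<^sub>i\<close>. The function \<open>x \<mapsto> (1 - x\<^sup>2) / x\<close> decreases from infinity to 0 on the unit
  interval. Hence for prescribed positive values \<open>y\<^sub>i\<close> there is exactly one factor \<open>c > 0\<close> for which the
  solutions of \<open>(1 - x\<^sub>i\<^sup>2) / x\<^sub>i = c y\<^sub>i\<close> add up to 1 (\<open>shares_exist\<close>, \<open>shares_unique\<close>). Undoing the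
  substitution gives \<open>diagonal_existence\<close> and \<open>diagonal_uniqueness\<close>.

  In these variables the pinching estimate is immediate. If \<open>a \<ge> b \<ge> c\<close>, then \<open>x\<^sub>1 \<le> x\<^sub>2 \<le> x\<^sub>3\<close>, and the
  ratio of the extreme cross curvature eigenvalues is \<open>a / c\<close> times \<open>x\<^sub>3 / x\<^sub>1 \<ge> 1\<close>, with equality
  exactly when \<open>a = c\<close> (\<open>diagonal_pinching\<close>).

  Uniqueness of the metric also needs a comparison of frames. Two solutions are diagonal in possibly
  different frames, and \<open>Y\<close> is diagonal in both. Ordering the eigenvalues makes the eigenvalues of \<open>Y\<close>,
  hence those of the metrics, agree. The rotation between the frames then preserves each eigenspace of
  \<open>Y\<close>, and on each of these both metrics are the same multiple of the bi-invariant one.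
\<close>

section \<open>The cross curvature equation for eigenvalues\<close>

text \<open>For the left-invariant metric with eigenvalues \<open>a, b, c\<close> in a bi-invariantly orthonormal frame, this is
the sectional curvature of the plane spanned by the second and third frame vectors.\<close>

definition sec_curv :: "real \<Rightarrow> real \<Rightarrow> real \<Rightarrow> real" where
  "sec_curv a b c = ((b - c)\<^sup>2 + 2 * a * (b + c) - 3 * a\<^sup>2) / (4 * a * b * c)"

lemma sec_curv_commute: "sec_curv a b c = sec_curv a c b"
  by (simp add: sec_curv_def power2_commute[of b c] add.commute[of b c] mult_ac)

text \<open>The first eigenvalue of the cross curvature. The Einstein endomorphism has determinant \<open>-k\<^sub>1 k\<^sub>2 k\<^sub>3\<close>
and first eigenvalue \<open>-k\<^sub>1\<close>, so the quotient of the two leaves the curvatures of the other two planes.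
The remaining eigenvalues arise by cyclic permutation of the arguments.\<close>

definition cross_eigenvalue :: "real \<Rightarrow> real \<Rightarrow> real \<Rightarrow> real" where
  "cross_eigenvalue a b c = a * sec_curv b c a * sec_curv c a b"

lemma sec_curv_add:
  assumes "a > 0" "b > 0" "c > 0"
  shows "(b + c - a) * (a + c - b) = 2 * (a * b * c) * (sec_curv a b c + sec_curv b c a)"
  using assms by (simp add: sec_curv_def field_simps) algebra

text \<open>Positive cross curvature eigenvalues force the three curvatures to have one sign. If all were
negative, \<open>sec_curv_add\<close> would make the pairwise products of \<open>b + c - a\<close>, \<open>c + a - b\<close>, \<open>a + b - c\<close> all
negative, whereas the product of these products is a square.\<close>

lemma sec_curv_all_pos:
  assumes pos: "a > 0" "b > 0" "c > 0"
    and X: "cross_eigenvalue a b c > 0" "cross_eigenvalue b c a > 0" "cross_eigenvalue c a b > 0"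
  shows "sec_curv a b c > 0 \<and> sec_curv b c a > 0 \<and> sec_curv c a b > 0"
proof (rule ccontr)
  assume non: "\<not> ?thesis"
  have bc: "sec_curv b c a * sec_curv c a b > 0" and ca: "sec_curv c a b * sec_curv a b c > 0"
    and ab: "sec_curv a b c * sec_curv b c a > 0"
    using X pos unfolding cross_eigenvalue_def by (auto simp: mult.assoc zero_less_mult_iff)
  have "sec_curv a b c + sec_curv b c a < 0" "sec_curv b c a + sec_curv c a b < 0" "sec_curv c a b + sec_curv a b c < 0"
    using non ab bc ca by (auto simp: zero_less_mult_iff)
  then have "(b + c - a) * (a + c - b) < 0" "(c + a - b) * (b + a - c) < 0"
    "(a + b - c) * (c + b - a) < 0"
    unfolding sec_curv_add[OF pos] sec_curv_add[OF pos(2,3,1)] sec_curv_add[OF pos(3,1,2)]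
    using pos by (simp_all add: mult_pos_neg)
  then show False
    by (auto simp: mult_less_0_iff)
qed

text \<open>Here \<open>x, y, z\<close> are the three sectional curvatures divided by their sum; this reading is
justified by \<open>sec_curv_shares\<close>, and \<open>t\<close> is the remaining overall scale.\<close>

definition curvature_shares ::
  "real \<Rightarrow> real \<Rightarrow> real \<Rightarrow> real \<Rightarrow> real \<Rightarrow> real \<Rightarrow> real \<Rightarrow> bool" where
  "curvature_shares t x y z a b c \<longleftrightarrow> t > 0 \<and> x > 0 \<and> y > 0 \<and> z > 0 \<and> x + y + z = 1 \<and>
     a = t * (1 - x\<^sup>2) \<and> b = t * (1 - y\<^sup>2) \<and> c = t * (1 - z\<^sup>2)"

lemma curvature_shares_rotate:
  "curvature_shares t x y z a b c \<Longrightarrow> curvature_shares t y z x b c a"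
  by (simp add: curvature_shares_def)

lemma curvature_shares_pos:
  assumes "curvature_shares t x y z a b c"
  shows "a > 0"
proof -
  have "x < 1" "x > 0" "t > 0" using assms by (auto simp: curvature_shares_def)
  then have "x\<^sup>2 < 1" by (simp add: power_less_one_iff)
  then show ?thesis using assms by (simp add: curvature_shares_def)
qed

text \<open>In terms of \<open>p = b + c - a\<close>, \<open>q = c + a - b\<close>, \<open>r = a + b - c\<close> the numerators of the curvatures are
\<open>e - 2 q r\<close>, \<open>e - 2 r p\<close>, \<open>e - 2 p q\<close> with \<open>e = p q + q r + r p\<close>, so they sum to \<open>e\<close>. Then \<open>1 - x\<close> and
\<open>1 + x\<close> factor as \<open>2 q r / e\<close> and \<open>2 p (q + r) / e\<close>, whose product is a multiple of \<open>a = (q + r) / 2\<close>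
with a factor symmetric in \<open>p, q, r\<close>.\<close>

lemma curvature_shares_exist:
  assumes pos: "a > 0" "b > 0" "c > 0" and K: "sec_curv a b c > 0" "sec_curv b c a > 0" "sec_curv c a b > 0"
  shows "\<exists>t x y z. curvature_shares t x y z a b c"
proof -
  define p q r where m: "p = b + c - a" "q = c + a - b" "r = a + b - c"
  have D: "a * b * c > 0" using pos by simp
  have "p * q > 0" "q * r > 0" "r * p > 0"
    using sec_curv_add[OF pos] sec_curv_add[OF pos(2,3,1)] sec_curv_add[OF pos(3,1,2)] K pos
    by (simp_all add: m add.commute)
  moreover have "p + q + r > 0" using pos by (simp add: m)
  ultimately have mp: "p > 0" "q > 0" "r > 0"
    by (auto simp: zero_less_mult_iff)
  define e where "e = p * q + q * r + r * p"
  have e: "e > 0" using mp by (simp add: e_def add_pos_pos)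
  have num: "(b - c)\<^sup>2 + 2 * a * (b + c) - 3 * a\<^sup>2 = e - 2 * q * r"
    "(c - a)\<^sup>2 + 2 * b * (c + a) - 3 * b\<^sup>2 = e - 2 * r * p"
    "(a - b)\<^sup>2 + 2 * c * (a + b) - 3 * c\<^sup>2 = e - 2 * p * q"
    unfolding e_def m by algebra+
  have x: "e - 2 * q * r > 0" "e - 2 * r * p > 0" "e - 2 * p * q > 0"
    using K pos D unfolding sec_curv_def num by (auto simp: zero_less_divide_iff)
  define t where "t = e\<^sup>2 / (8 * p * q * r)"
  have "curvature_shares t ((e - 2 * q * r) / e) ((e - 2 * r * p) / e) ((e - 2 * p * q) / e) a b c"
    unfolding curvature_shares_def
  proof (intro conjI)
    show "t > 0" using e mp by (simp add: t_def)
    show "(e - 2 * q * r) / e + (e - 2 * r * p) / e + (e - 2 * p * q) / e = 1"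
    proof -
      have "(e - 2 * q * r) + (e - 2 * r * p) + (e - 2 * p * q) = e"
        unfolding e_def by algebra
      then show ?thesis using e by (simp add: add_divide_distrib[symmetric])
    qed
    have *: "e\<^sup>2 / (8 * p' * q' * r') * (1 - ((e - 2 * q' * r') / e)\<^sup>2) = (q' + r') / 2"
      if "p' * q' + q' * r' + r' * p' = e" "p' > 0" "q' > 0" "r' > 0" for p' q' r'
    proof -
      have "e\<^sup>2 * (1 - ((e - 2 * q' * r') / e)\<^sup>2) = e\<^sup>2 - (e - 2 * q' * r')\<^sup>2"
        using e by (simp add: power_divide right_diff_distrib)
      also have "\<dots> = 4 * p' * q' * r' * (q' + r')"
        unfolding that(1)[symmetric] by algebra
      finally have h: "e\<^sup>2 * (1 - ((e - 2 * q' * r') / e)\<^sup>2) = 4 * p' * q' * r' * (q' + r')" .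
      have "e\<^sup>2 / (8 * p' * q' * r') * (1 - ((e - 2 * q' * r') / e)\<^sup>2)
          = (e\<^sup>2 * (1 - ((e - 2 * q' * r') / e)\<^sup>2)) / (8 * p' * q' * r')" by simp
      also have "\<dots> = (q' + r') / 2" unfolding h using that by simp
      finally show ?thesis .
    qed
    have abc: "a = (q + r) / 2" "b = (r + p) / 2" "c = (p + q) / 2"
      by (simp_all add: m)
    have rot: "q * r + r * p + p * q = e" "r * p + p * q + q * r = e"
      "t = e\<^sup>2 / (8 * q * r * p)" "t = e\<^sup>2 / (8 * r * p * q)"
      by (simp_all add: e_def t_def mult_ac)
    show "a = t * (1 - ((e - 2 * q * r) / e)\<^sup>2)"
      unfolding abc using *[OF e_def[symmetric] mp] by (simp add: t_def)
    show "b = t * (1 - ((e - 2 * r * p) / e)\<^sup>2)"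
      unfolding abc using *[OF rot(1) mp(2,3,1)] rot(3) by simp
    show "c = t * (1 - ((e - 2 * p * q) / e)\<^sup>2)"
      unfolding abc using *[OF rot(2) mp(3,1,2)] rot(4) by simp
  qed (use x e in simp_all)
  then show ?thesis by blast
qed

lemma sec_curv_shares:
  assumes S: "curvature_shares t x y z a b c"
  shows "sec_curv a b c = 2 * x / (t * ((1 + x) * (1 + y) * (1 + z)))"
proof -
  have pos: "a > 0" "b > 0" "c > 0" "t > 0" "x > 0" "y > 0" "z > 0" and s: "x + y + z = 1"
    and abc: "a = t * (1 - x\<^sup>2)" "b = t * (1 - y\<^sup>2)" "c = t * (1 - z\<^sup>2)"
    using S curvature_shares_pos[OF S] curvature_shares_pos[OF curvature_shares_rotate[OF S]]
      curvature_shares_pos[OF curvature_shares_rotate[OF curvature_shares_rotate[OF S]]]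
    by (auto simp: curvature_shares_def)
  have "((b - c)\<^sup>2 + 2 * a * (b + c) - 3 * a\<^sup>2) = 8 * t\<^sup>2 * x * ((1 - x) * (1 - y) * (1 - z))"
    unfolding abc using s by algebra
  moreover have "a * b * c = t ^ 3 * ((1 - x) * (1 - y) * (1 - z)) * ((1 + x) * (1 + y) * (1 + z))"
    unfolding abc by algebra
  ultimately have "((b - c)\<^sup>2 + 2 * a * (b + c) - 3 * a\<^sup>2) * (t * ((1 + x) * (1 + y) * (1 + z)))
      = 2 * x * (4 * a * b * c)"
    by algebra
  then show ?thesis
    using pos unfolding sec_curv_def by (subst frac_eq_eq) auto
qed

lemma cross_eigenvalue_curvature_shares:
  assumes S: "curvature_shares t x y z a b c"
  shows "cross_eigenvalue a b c
    = 4 * x * y * z / (t * ((1 + x) * (1 + y) * (1 + z))\<^sup>2) * ((1 - x\<^sup>2) / x)"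
proof -
  have *: "t > 0" "x > 0" "y > 0" "z > 0" "a = t * (1 - x\<^sup>2)"
    using S by (auto simp: curvature_shares_def)
  define Q where "Q = (1 + x) * (1 + y) * (1 + z)"
  have Q: "Q > 0" using * by (simp add: Q_def)
  have "sec_curv b c a = 2 * y / (t * Q)" "sec_curv c a b = 2 * z / (t * Q)"
    using sec_curv_shares[OF curvature_shares_rotate[OF S]]
      sec_curv_shares[OF curvature_shares_rotate[OF curvature_shares_rotate[OF S]]]
    by (simp_all add: Q_def mult_ac)
  then have "cross_eigenvalue a b c = a * (2 * y / (t * Q)) * (2 * z / (t * Q))"
    by (simp add: cross_eigenvalue_def)
  also have "\<dots> = t * (1 - x\<^sup>2) * (2 * y / (t * Q)) * (2 * z / (t * Q))"
    using *(5) by simp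
  also have "\<dots> = 4 * x * y * z / (t * Q\<^sup>2) * ((1 - x\<^sup>2) / x)"
    using *(1-4) Q by (simp add: field_simps power2_eq_square)
  finally show ?thesis unfolding Q_def .
qed

text \<open>The function equals \<open>1 / x - x\<close>, a sum of two decreasing functions.\<close>

lemma share_gauge_strict_antimono:
  fixes x y :: real
  assumes "0 < x" "x < y"
  shows "(1 - y\<^sup>2) / y < (1 - x\<^sup>2) / x"
proof -
  have "1 / y < 1 / x" using assms by (simp add: frac_less2)
  moreover have "(1 - u\<^sup>2) / u = 1 / u - u" if "u > 0" for u :: real
    using that by (simp add: field_simps power2_eq_square)
  ultimately show ?thesis using assms by auto
qed

lemma share_gauge_le_iff:
  fixes x y :: real
  assumes "0 < x" "0 < y"
  shows "(1 - y\<^sup>2) / y \<le> (1 - x\<^sup>2) / x \<longleftrightarrow> x \<le> y"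
  using share_gauge_strict_antimono[of x y] share_gauge_strict_antimono[of y x] assms
  by (cases x y rule: linorder_cases) auto

text \<open>A larger factor \<open>k'\<close> forces smaller values of the decreasing function, hence larger shares in all
three places, which is impossible if both triples sum to 1.\<close>

lemma shares_unique:
  fixes x y z :: real
  assumes "x > 0" "y > 0" "z > 0" "x + y + z = 1" "x' > 0" "y' > 0" "z' > 0" "x' + y' + z' = 1"
    and k: "k > 0" "k' > 0"
    and e: "k * ((1 - x\<^sup>2) / x) = k' * ((1 - x'\<^sup>2) / x')"
      "k * ((1 - y\<^sup>2) / y) = k' * ((1 - y'\<^sup>2) / y')"
      "k * ((1 - z\<^sup>2) / z) = k' * ((1 - z'\<^sup>2) / z')"
  shows "x = x' \<and> y = y' \<and> z = z' \<and> k = k'"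
proof -
  have main: "k = k'" if "x > 0" "y > 0" "z > 0" "x + y + z = 1"
    "x' > 0" "y' > 0" "z' > 0" "x' + y' + z' = 1" "k > 0" "k' > 0"
    "k * ((1 - x\<^sup>2) / x) = k' * ((1 - x'\<^sup>2) / x')"
    "k * ((1 - y\<^sup>2) / y) = k' * ((1 - y'\<^sup>2) / y')"
    "k * ((1 - z\<^sup>2) / z) = k' * ((1 - z'\<^sup>2) / z')"
    "k \<le> k'" for x y z x' y' z' k k' :: real
  proof (rule ccontr)
    assume "k \<noteq> k'"
    with that have kk: "k < k'" by simp
    have less: "u < u'" if "u > 0" "u < 1" "u' > 0" "u' < 1"
        "k * ((1 - u\<^sup>2) / u) = k' * ((1 - u'\<^sup>2) / u')" for u u' :: real
    proof (rule ccontr)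
      assume "\<not> u < u'"
      then have "(1 - u\<^sup>2) / u \<le> (1 - u'\<^sup>2) / u'"
        using share_gauge_le_iff[of u' u] that by simp
      moreover have "(1 - u'\<^sup>2) / u' > 0" using that by (simp add: power_less_one_iff)
      ultimately have "k * ((1 - u\<^sup>2) / u) < k' * ((1 - u'\<^sup>2) / u')"
        using kk \<open>k > 0\<close> by (meson less_le_trans mult_left_mono mult_strict_right_mono
            order_le_less_trans less_imp_le)
      then show False using that by simp
    qed
    have "x < x'" by (rule less) (use that in linarith)+
    moreover have "y < y'" by (rule less) (use that in linarith)+
    moreover have "z < z'" by (rule less) (use that in linarith)+
    ultimately show False using that(4,8) by linarith
  qed
  \<comment> \<open>The situation is symmetric in the two triples, so ordering the factors loses nothing.\<close>
  have "k = k'"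
    using main[of x y z x' y' z' k k'] main[of x' y' z' x y z k' k] assms by argo
  moreover have "u = u'" if "u > 0" "u' > 0" "k * ((1 - u\<^sup>2) / u) = k' * ((1 - u'\<^sup>2) / u')" for u u'
  proof -
    have "(1 - u\<^sup>2) / u = (1 - u'\<^sup>2) / u'"
      using that(3) \<open>k = k'\<close> k(1) by (metis mult_left_cancel less_irrefl)
    then show ?thesis
      using share_gauge_le_iff[of u u'] share_gauge_le_iff[of u' u] that by linarith
  qed
  ultimately show ?thesis using assms by blast
qed

text \<open>For fixed \<open>c\<close> each equation is quadratic with the positive root \<open>s (c * u)\<close>. The sum of the three roots
is 3 at \<open>c = 0\<close> and at most 1 for large \<open>c\<close>, so the intermediate value theorem provides the factor.\<close>

lemma shares_exist:
  fixes u v w :: real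
  assumes pos: "u > 0" "v > 0" "w > 0"
  shows "\<exists>c x y z. c > 0 \<and> x > 0 \<and> y > 0 \<and> z > 0 \<and> x + y + z = 1 \<and>
    (1 - x\<^sup>2) / x = c * u \<and> (1 - y\<^sup>2) / y = c * v \<and> (1 - z\<^sup>2) / z = c * w"
proof -
  define s where "s d = (sqrt (d\<^sup>2 + 4) - d) / 2" for d :: real
  have s_pos: "s d > 0" for d
  proof -
    have "\<bar>d\<bar> < sqrt (d\<^sup>2 + 4)" by (rule real_less_rsqrt) simp
    then show ?thesis by (simp add: s_def abs_less_iff)
  qed
  have s_root: "(s d)\<^sup>2 + d * s d = 1" for d
    by (simp add: s_def power2_eq_square field_simps)
  have s_gauge: "(1 - (s d)\<^sup>2) / s d = d" for d
    using s_root[of d] s_pos[of d] by (simp add: field_simps)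
  have s_less: "s d \<le> 1 / d" if "d > 0" for d
  proof -
    have "d * s d \<le> 1" using s_root[of d] by (smt (verit) zero_le_power2)
    then show ?thesis using that by (simp add: field_simps)
  qed
  have s_third: "s d \<le> 1 / 3" if "d \<ge> 3" for d
    using s_less[of d] that frac_le[of 1 1 3 d] by linarith
  define f where "f c = s (c * u) + s (c * v) + s (c * w)" for c
  \<comment> \<open>At this factor every argument of \<open>s\<close> is at least 3, hence every root at most 1/3.\<close>
  define C where "C = 3 / Min {u, v, w}"
  have Cpos: "C > 0" using pos by (simp add: C_def)
  have "C * u \<ge> 3" "C * v \<ge> 3" "C * w \<ge> 3"
    using pos by (auto simp: C_def field_simps)
  then have third: "s (C * u) \<le> 1 / 3" "s (C * v) \<le> 1 / 3" "s (C * w) \<le> 1 / 3"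
    using s_third by auto
  have "f C \<le> 1" using third by (simp add: f_def)
  moreover have "f 0 \<ge> 1" by (simp add: f_def s_def)
  moreover have "continuous_on {0..C} f"
    unfolding f_def s_def by (intro continuous_intros) auto
  ultimately obtain c where c: "0 \<le> c" "c \<le> C" "f c = 1"
    using IVT2'[of f C 1 0] Cpos by auto
  moreover have "c \<noteq> 0" using c by (auto simp: f_def s_def)
  ultimately show ?thesis
    using s_pos s_gauge by (intro exI[of _ c] exI[of _ "s (c * u)"] exI[of _ "s (c * v)"]
        exI[of _ "s (c * w)"]) (auto simp: f_def)
qed

lemma diagonal_existence:
  assumes pos: "u > 0" "v > 0" "w > 0"
  obtains a b c where "a > 0" "b > 0" "c > 0"
    "cross_eigenvalue a b c = u" "cross_eigenvalue b c a = v" "cross_eigenvalue c a b = w"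
    "sec_curv a b c > 0" "sec_curv b c a > 0" "sec_curv c a b > 0"
proof -
  obtain d x y z where d: "d > 0" "x > 0" "y > 0" "z > 0" "x + y + z = 1"
    "(1 - x\<^sup>2) / x = d * u" "(1 - y\<^sup>2) / y = d * v" "(1 - z\<^sup>2) / z = d * w"
    using shares_exist[OF pos] by blast
  define Q where "Q = (1 + x) * (1 + y) * (1 + z)"
  have Q: "Q > 0" using d by (simp add: Q_def)
  \<comment> \<open>The scale for which the factor in \<open>cross_eigenvalue_curvature_shares\<close> becomes \<open>1 / d\<close>.\<close>
  define t where "t = 4 * x * y * z * d / Q\<^sup>2"
  have t: "t > 0" using d Q by (simp add: t_def)
  have fac: "4 * x * y * z / (t * Q\<^sup>2) * d = 1"
    using d Q by (simp add: t_def)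
  let ?a = "t * (1 - x\<^sup>2)" and ?b = "t * (1 - y\<^sup>2)" and ?c = "t * (1 - z\<^sup>2)"
  have S1: "curvature_shares t x y z ?a ?b ?c" using d t by (simp add: curvature_shares_def)
  note S2 = curvature_shares_rotate[OF S1]
  note S3 = curvature_shares_rotate[OF S2]
  have Qr: "(1 + y) * (1 + z) * (1 + x) = Q" "(1 + z) * (1 + x) * (1 + y) = Q"
    "4 * y * z * x = 4 * x * y * z" "4 * z * x * y = 4 * x * y * z"
    by (simp_all add: Q_def mult_ac)
  have eig: "4 * x * y * z / (t * Q\<^sup>2) * (d * u') = u'" for u'
    using fac by (metis mult.assoc mult_1)
  show thesis
  proof (rule that)
    show "cross_eigenvalue ?a ?b ?c = u" "cross_eigenvalue ?b ?c ?a = v"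
      "cross_eigenvalue ?c ?a ?b = w"
      unfolding S1[THEN cross_eigenvalue_curvature_shares] S2[THEN cross_eigenvalue_curvature_shares]
        S3[THEN cross_eigenvalue_curvature_shares] d Qr Q_def[symmetric] eig by (rule refl)+
    show "sec_curv ?a ?b ?c > 0" "sec_curv ?b ?c ?a > 0" "sec_curv ?c ?a ?b > 0"
      using sec_curv_shares[OF S1] sec_curv_shares[OF S2] sec_curv_shares[OF S3] d t
      by simp_all
  qed (use curvature_shares_pos S1 S2 S3 in blast)+
qed

lemma shares_of_positive_cross_eigenvalues:
  assumes pos: "a > 0" "b > 0" "c > 0"
    and X: "cross_eigenvalue a b c > 0" "cross_eigenvalue b c a > 0" "cross_eigenvalue c a b > 0"
  obtains t x y z k where "curvature_shares t x y z a b c" "k > 0"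
    "k = 4 * x * y * z / (t * ((1 + x) * (1 + y) * (1 + z))\<^sup>2)"
    "cross_eigenvalue a b c = k * ((1 - x\<^sup>2) / x)"
    "cross_eigenvalue b c a = k * ((1 - y\<^sup>2) / y)"
    "cross_eigenvalue c a b = k * ((1 - z\<^sup>2) / z)"
proof -
  obtain t x y z where S1: "curvature_shares t x y z a b c"
    using curvature_shares_exist sec_curv_all_pos assms by metis
  note S2 = curvature_shares_rotate[OF S1]
  note S3 = curvature_shares_rotate[OF S2]
  let ?k = "4 * x * y * z / (t * ((1 + x) * (1 + y) * (1 + z))\<^sup>2)"
  show thesis
  proof (rule that[OF S1, of ?k])
    show "?k > 0"
      using S1 by (auto simp: curvature_shares_def intro!: divide_pos_pos mult_pos_pos zero_less_power)
  qed (use cross_eigenvalue_curvature_shares[OF S1] cross_eigenvalue_curvature_shares[OF S2]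
        cross_eigenvalue_curvature_shares[OF S3] in \<open>simp_all add: mult_ac\<close>)
qed

text \<open>The shares and the common factor \<open>k\<close> are determined by \<open>shares_unique\<close>, and \<open>k\<close> together with the shares
determines the scale \<open>t\<close>.\<close>

lemma diagonal_uniqueness:
  assumes pos: "a > 0" "b > 0" "c > 0" "a' > 0" "b' > 0" "c' > 0"
    and X: "cross_eigenvalue a b c > 0" "cross_eigenvalue b c a > 0" "cross_eigenvalue c a b > 0"
    and eq: "cross_eigenvalue a b c = cross_eigenvalue a' b' c'"
    "cross_eigenvalue b c a = cross_eigenvalue b' c' a'"
    "cross_eigenvalue c a b = cross_eigenvalue c' a' b'"
  shows "a = a' \<and> b = b' \<and> c = c'"
proof -
  obtain t x y z k where S: "curvature_shares t x y z a b c" and k: "k > 0"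
    "k = 4 * x * y * z / (t * ((1 + x) * (1 + y) * (1 + z))\<^sup>2)"
    "cross_eigenvalue a b c = k * ((1 - x\<^sup>2) / x)"
    "cross_eigenvalue b c a = k * ((1 - y\<^sup>2) / y)"
    "cross_eigenvalue c a b = k * ((1 - z\<^sup>2) / z)"
    using shares_of_positive_cross_eigenvalues[of a b c] pos X by blast
  obtain t' x' y' z' k' where S': "curvature_shares t' x' y' z' a' b' c'" and k': "k' > 0"
    "k' = 4 * x' * y' * z' / (t' * ((1 + x') * (1 + y') * (1 + z'))\<^sup>2)"
    "cross_eigenvalue a' b' c' = k' * ((1 - x'\<^sup>2) / x')"
    "cross_eigenvalue b' c' a' = k' * ((1 - y'\<^sup>2) / y')"
    "cross_eigenvalue c' a' b' = k' * ((1 - z'\<^sup>2) / z')"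
    using shares_of_positive_cross_eigenvalues[of a' b' c'] pos X eq by metis
  have xk: "x = x' \<and> y = y' \<and> z = z' \<and> k = k'"
  proof (rule shares_unique)
    show "k * ((1 - x\<^sup>2) / x) = k' * ((1 - x'\<^sup>2) / x')"
      "k * ((1 - y\<^sup>2) / y) = k' * ((1 - y'\<^sup>2) / y')"
      "k * ((1 - z\<^sup>2) / z) = k' * ((1 - z'\<^sup>2) / z')"
      using k(3-5) k'(3-5) eq by argo+
  qed (use S S' k(1) k'(1) in \<open>simp_all only: curvature_shares_def\<close>)
  have xyz: "x > 0" "y > 0" "z > 0" "t > 0" "t' > 0"
    using S S' by (auto simp: curvature_shares_def)
  define Q where "Q = (1 + x) * (1 + y) * (1 + z)"
  have Q: "Q > 0" using xyz by (simp add: Q_def)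
  have "4 * x * y * z / (t * Q\<^sup>2) = 4 * x * y * z / (t' * Q\<^sup>2)"
    using k(2) k'(2) xk unfolding Q_def by metis
  then have "4 * x * y * z / Q\<^sup>2 / t = 4 * x * y * z / Q\<^sup>2 / t'"
    by (simp add: mult.commute)
  moreover have "4 * x * y * z / Q\<^sup>2 > 0" using xyz Q by simp
  ultimately have "t = t'" using xyz by (metis divide_cancel_left less_irrefl)
  with xk S S' show ?thesis by (simp add: curvature_shares_def)
qed

text \<open>The cross curvature eigenvalues are the metric eigenvalues divided by the respective shares, up to a
common factor. Larger metric eigenvalues come with smaller shares, so the division preserves the order
and can only increase ratios.\<close>

lemma diagonal_pinching:
  assumes pos: "a > 0" "b > 0" "c > 0"
    and X: "cross_eigenvalue a b c > 0" "cross_eigenvalue b c a > 0" "cross_eigenvalue c a b > 0"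
    and sorted: "a \<ge> b" "b \<ge> c"
  shows "cross_eigenvalue a b c \<ge> cross_eigenvalue b c a"
    and "cross_eigenvalue b c a \<ge> cross_eigenvalue c a b"
    and "a / c \<le> cross_eigenvalue a b c / cross_eigenvalue c a b"
    and "a / c = cross_eigenvalue a b c / cross_eigenvalue c a b \<longleftrightarrow> a = c"
proof -
  obtain t x y z k where S: "curvature_shares t x y z a b c" and k: "k > 0"
    "cross_eigenvalue a b c = k * ((1 - x\<^sup>2) / x)"
    "cross_eigenvalue b c a = k * ((1 - y\<^sup>2) / y)"
    "cross_eigenvalue c a b = k * ((1 - z\<^sup>2) / z)"
    using shares_of_positive_cross_eigenvalues[OF pos X] by metis
  have xyz: "x > 0" "y > 0" "z > 0" "t > 0" "a = t * (1 - x\<^sup>2)" "b = t * (1 - y\<^sup>2)"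
    "c = t * (1 - z\<^sup>2)"
    using S by (auto simp: curvature_shares_def)
  have xy: "x \<le> y" and yz: "y \<le> z"
    using sorted xyz by (auto simp: abs_le_square_iff[symmetric])
  show "cross_eigenvalue a b c \<ge> cross_eigenvalue b c a"
    "cross_eigenvalue b c a \<ge> cross_eigenvalue c a b"
    unfolding k(2-4) using k(1) xy yz share_gauge_le_iff xyz(1-3)
    by (simp_all only: mult_le_cancel_left_pos)
  have nz: "1 - z\<^sup>2 > 0" using xyz pos by (simp add: zero_less_mult_iff)
  have "cross_eigenvalue a b c / cross_eigenvalue c a b = ((1 - x\<^sup>2) / x) / ((1 - z\<^sup>2) / z)"
    unfolding k using k(1) by simp
  also have "\<dots> = ((1 - x\<^sup>2) / (1 - z\<^sup>2)) * (z / x)" by simp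
  also have "(1 - x\<^sup>2) / (1 - z\<^sup>2) = a / c" using xyz nz by simp
  finally have r: "cross_eigenvalue a b c / cross_eigenvalue c a b = (a / c) * (z / x)" .
  have "z / x \<ge> 1" using xyz xy yz by simp
  then show "a / c \<le> cross_eigenvalue a b c / cross_eigenvalue c a b"
    unfolding r using pos by (metis mult.right_neutral mult_left_mono divide_nonneg_pos less_imp_le)
  have "a / c = cross_eigenvalue a b c / cross_eigenvalue c a b \<longleftrightarrow> z / x = 1"
    unfolding r using pos by (simp only: mult_cancel_left1 divide_eq_0_iff) auto
  also have "\<dots> \<longleftrightarrow> z = x" using xyz by auto
  also have "\<dots> \<longleftrightarrow> a = c"
    using xyz(1,3,4) unfolding xyz(5,7) by auto
  finally show "a / c = cross_eigenvalue a b c / cross_eigenvalue c a b \<longleftrightarrow> a = c" .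
qed

text \<open>Exchanging \<open>a\<close> and \<open>b\<close> then leaves the three cross curvature eigenvalues unchanged, so uniqueness of
the solution applies.\<close>

lemma cross_eigenvalue_inj:
  assumes pos: "a > 0" "b > 0" "c > 0"
    and X: "cross_eigenvalue a b c > 0" "cross_eigenvalue b c a > 0" "cross_eigenvalue c a b > 0"
    and eq: "cross_eigenvalue a b c = cross_eigenvalue b c a"
  shows "a = b"
proof -
  have sym: "cross_eigenvalue b a c = cross_eigenvalue b c a" "cross_eigenvalue a c b = cross_eigenvalue a b c"
    "cross_eigenvalue c b a = cross_eigenvalue c a b"
    unfolding cross_eigenvalue_def sec_curv_commute[of b a c] sec_curv_commute[of c a b] sec_curv_commute[of a b c]
    by (simp_all add: mult_ac)
  show ?thesis
    by (rule conjunct1[OF diagonal_uniqueness[OF pos pos(2,1,3) X]]) (use sym eq in linarith)+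
qed

section \<open>Diagonalising symmetric forms on three-space\<close>

definition diag_form :: "real^3 \<Rightarrow> real^3 \<Rightarrow> real^3 \<Rightarrow> real" where
  "diag_form l u v = (\<Sum>i\<in>UNIV. l $ i * u $ i * v $ i)"

lemma diag_form_3: "diag_form l u v = l $ 1 * u $ 1 * v $ 1 + l $ 2 * u $ 2 * v $ 2 + l $ 3 * u $ 3 * v $ 3"
  by (simp add: diag_form_def sum_3)

text \<open>The first variation at a maximum of the quadratic form on the unit sphere of \<open>S\<close> vanishes. The test
vector \<open>f + t w\<close> with the explicit step \<open>t\<close> below replaces differentiation.\<close>

lemma maximizer_orthogonal:
  fixes b :: "'a::real_inner \<Rightarrow> 'a \<Rightarrow> real"
  assumes b: "bilinear b" and sym: "\<And>u v. b u v = b v u" and S: "subspace S"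
    and f: "f \<in> S" "norm f = 1" and max: "\<And>v. v \<in> S \<Longrightarrow> b v v \<le> b f f * (norm v)\<^sup>2"
    and w: "w \<in> S" "f \<bullet> w = 0"
  shows "b f w = 0"
proof (rule ccontr)
  assume nz: "b f w \<noteq> 0"
  \<comment> \<open>The bound \<open>C\<close> dominates the second-order terms, so a step of size \<open>b f w / C\<close> gains to first order.\<close>
  define C where "C = \<bar>b w w\<bar> + \<bar>b f f\<bar> * (norm w)\<^sup>2 + 1"
  have C: "C > 0" by (simp add: C_def add_nonneg_pos)
  define t where "t = b f w / C"
  have exp: "b (f + t *\<^sub>R w) (f + t *\<^sub>R w) = b f f + 2 * t * b f w + t\<^sup>2 * b w w"
    using sym[of w f] by (simp add: bilinear_ladd[OF b] bilinear_radd[OF b] bilinear_lmul[OF b]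
        bilinear_rmul[OF b] power2_eq_square algebra_simps)
  have nrm: "(norm (f + t *\<^sub>R w))\<^sup>2 = 1 + t\<^sup>2 * (norm w)\<^sup>2"
    using f w unfolding power2_norm_eq_inner
    by (simp add: inner_add_left inner_add_right inner_commute[of w f] norm_eq_1 power2_eq_square)
  have "b f f + 2 * t * b f w + t\<^sup>2 * b w w \<le> b f f * (1 + t\<^sup>2 * (norm w)\<^sup>2)"
    using max[of "f + t *\<^sub>R w"] S f w unfolding exp nrm by (simp add: subspace_add subspace_mul)
  then have "2 * t * b f w \<le> t\<^sup>2 * (b f f * (norm w)\<^sup>2 - b w w)"
    by (simp add: algebra_simps)
  also have "\<dots> \<le> t\<^sup>2 * C"
    unfolding C_def by (intro mult_left_mono) (auto intro: add_mono, smt (verit) abs_ge_self mult_right_mono zero_le_power2)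
  also have "\<dots> = t * b f w" using C by (simp add: t_def power2_eq_square)
  finally have "t * b f w \<le> 0" by simp
  moreover have "t * b f w > 0" using nz C by (simp add: t_def power2_eq_square[symmetric])
  ultimately show False by simp
qed

lemma maximizer_exists:
  fixes b :: "'a::euclidean_space \<Rightarrow> 'a \<Rightarrow> real"
  assumes b: "bilinear b" and S: "subspace S" "S \<noteq> {0}"
  obtains f where "f \<in> S" "norm f = 1" "\<And>v. v \<in> S \<Longrightarrow> b v v \<le> b f f * (norm v)\<^sup>2"
proof -
  have bb: "bounded_bilinear b" using b by (simp add: bilinear_conv_bounded_bilinear)
  let ?K = "S \<inter> sphere 0 1"
  have "compact ?K" using S by (intro closed_Int_compact closed_subspace) auto
  moreover obtain s where s: "s \<in> S" "s \<noteq> 0" using S subspace_0 by blast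
  then have "s /\<^sub>R norm s \<in> ?K" using S by (simp add: subspace_mul)
  moreover have "continuous_on ?K (\<lambda>v. b v v)"
    by (intro bounded_bilinear.continuous_on[OF bb] continuous_intros)
  ultimately obtain f where f: "f \<in> ?K" "\<And>v. v \<in> ?K \<Longrightarrow> b v v \<le> b f f"
    using continuous_attains_sup[of ?K "\<lambda>v. b v v"] by blast
  show thesis
  proof (rule that[of f])
    fix v assume v: "v \<in> S"
    show "b v v \<le> b f f * (norm v)\<^sup>2"
    proof (cases "v = 0")
      case True then show ?thesis by (simp add: bilinear_lzero[OF b])
    next
      case False
      then have "b (v /\<^sub>R norm v) (v /\<^sub>R norm v) \<le> b f f"
        using f(2) v S by (simp add: subspace_mul)
      then show ?thesis using False
        by (simp add: bilinear_lmul[OF b] bilinear_rmul[OF b] field_simps power2_eq_square)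
    qed
  qed (use f in auto)
qed

text \<open>Maximising over the unit sphere gives the first column of \<open>R\<close>, maximising over the orthogonal plane the
second, and their cross product is the third. This choice also makes \<open>R\<close> a rotation, so that it
respects the bracket, and sorts the eigenvalues.\<close>

lemma symmetric_form_diagonalization:
  fixes b :: "real^3 \<Rightarrow> real^3 \<Rightarrow> real"
  assumes b: "bilinear b" and sym: "\<And>u v. b u v = b v u"
  obtains R :: "real^3^3" and l :: "real^3" where "rotation_matrix R" "l $ 1 \<ge> l $ 2" "l $ 2 \<ge> l $ 3"
    "\<And>u v. b (R *v u) (R *v v) = diag_form l u v"
proof -
  have "(UNIV :: (real^3) set) \<noteq> {0}"
    by (metis UNIV_I axis_eq_0_iff singletonD zero_neq_one)
  then obtain f1 where f1: "norm f1 = 1" "\<And>v. b v v \<le> b f1 f1 * (norm v)\<^sup>2"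
    using maximizer_exists[OF b subspace_UNIV] by auto
  define S where "S = {v. f1 \<bullet> v = 0}"
  have S: "subspace S" unfolding S_def by (rule subspace_hyperplane)
  have "dim S = 2" using f1 unfolding S_def by (subst dim_hyperplane) auto
  then have "S \<noteq> {0}" by auto
  then obtain f2 where f2: "f2 \<in> S" "norm f2 = 1" "\<And>v. v \<in> S \<Longrightarrow> b v v \<le> b f2 f2 * (norm v)\<^sup>2"
    using maximizer_exists[OF b S] by auto
  define f3 where "f3 = cross3 f1 f2"
  have o12: "f1 \<bullet> f2 = 0" using f2 by (simp add: S_def)
  have o13: "f1 \<bullet> f3 = 0" and o23: "f2 \<bullet> f3 = 0" by (simp_all add: f3_def dot_cross_self)
  have n3: "norm f3 = 1"
    using norm_cross_dot[of f1 f2] o12 f1 f2 by (simp add: f3_def abs_square_eq_1)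
  have b12: "b f1 f2 = 0" and b13: "b f1 f3 = 0"
    using maximizer_orthogonal[OF b sym subspace_UNIV, of f1] f1 o12 o13 by auto
  have b23: "b f2 f3 = 0"
    using maximizer_orthogonal[OF b sym S f2] o13 o23 by (auto simp: S_def)
  define R :: "real^3^3" where "R = transpose (vector [f1, f2, f3])"
  have Rv: "R *v v = v $ 1 *\<^sub>R f1 + v $ 2 *\<^sub>R f2 + v $ 3 *\<^sub>R f3" for v
    by (simp add: R_def matrix_vector_mult_def transpose_def vec_eq_iff sum_3 forall_3 algebra_simps)
  have "transpose R ** R = mat 1"
    using o12 o13 o23 f1(1) f2(2) n3
    by (simp add: R_def matrix_matrix_mult_def vec_eq_iff mat_def transpose_def forall_3 sum_3
        inner_vec_def norm_eq_1 mult.commute)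
  then have "orthogonal_matrix R" by (simp add: orthogonal_matrix)
  moreover have "det R = 1"
  proof -
    have "det R = f1 \<bullet> cross3 f2 f3" by (simp add: R_def det_transpose dot_cross_det)
    also have "\<dots> = (f1 \<bullet> f1) * (f2 \<bullet> f2) - (f1 \<bullet> f2) * (f1 \<bullet> f2)"
      unfolding f3_def by (simp add: cross3_simps)
    also have "\<dots> = 1" using f1 f2 o12 by (simp add: norm_eq_1)
    finally show ?thesis .
  qed
  ultimately have R: "rotation_matrix R" by (simp add: rotation_matrix_def)
  define l :: "real^3" where "l = vector [b f1 f1, b f2 f2, b f3 f3]"
  show thesis
  proof (rule that[OF R])
    show "l $ 1 \<ge> l $ 2" using f1(2)[of f2] f2(2) by (simp add: l_def)
    show "l $ 2 \<ge> l $ 3" using f2(3)[of f3] n3 o13 by (simp add: l_def S_def)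
    show "b (R *v u) (R *v v) = diag_form l u v" for u v
      using b12 b13 b23 sym[of f2 f1] sym[of f3 f1] sym[of f3 f2]
      by (simp add: Rv l_def diag_form_3 bilinear_ladd[OF b] bilinear_radd[OF b] bilinear_lmul[OF b]
          bilinear_rmul[OF b] algebra_simps)
  qed
qed

section \<open>The Lie algebra as three-space\<close>

definition su2_vec :: "real^3 \<Rightarrow> mat2" where
  "su2_vec v = (\<Sum>k\<in>UNIV. v $ k *\<^sub>R su2_basis k)"

lemma su2_vec_components:
  "su2_vec v $ 1 $ 1 = Complex 0 (v $ 3 / 2)"
  "su2_vec v $ 1 $ 2 = Complex (v $ 2 / 2) (v $ 1 / 2)"
  "su2_vec v $ 2 $ 1 = Complex (- v $ 2 / 2) (v $ 1 / 2)"
  "su2_vec v $ 2 $ 2 = Complex 0 (- v $ 3 / 2)"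
  by (simp_all add: su2_vec_def su2_basis_def sum_3 complex_eq_iff)

lemma linear_su2_vec: "linear su2_vec"
  by (intro linearI) (simp_all add: vec_eq_iff forall_2 su2_vec_components complex_eq_iff add_divide_distrib)

lemma mat2_eq_iff:
  "(A :: mat2) = B \<longleftrightarrow> A $ 1 $ 1 = B $ 1 $ 1 \<and> A $ 1 $ 2 = B $ 1 $ 2 \<and> A $ 2 $ 1 = B $ 2 $ 1 \<and> A $ 2 $ 2 = B $ 2 $ 2"
  by (auto simp: vec_eq_iff forall_2)

lemma mat2_mult_components: "((A :: mat2) ** B) $ i $ j = A $ i $ 1 * B $ 1 $ j + A $ i $ 2 * B $ 2 $ j"
  by (simp add: matrix_matrix_mult_def sum_2)

lemma range_su2_vec: "range su2_vec = su2"
proof (intro equalityI subsetI)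
  fix A assume "A \<in> range su2_vec"
  then show "A \<in> su2"
    by (auto simp: su2_def mat2_eq_iff ctranspose_def su2_vec_components trace_def sum_2 complex_eq_iff)
next
  fix A assume "A \<in> su2"
  then have h: "cnj (A $ 1 $ 1) = - A $ 1 $ 1" "cnj (A $ 1 $ 2) = - A $ 2 $ 1" "A $ 1 $ 1 + A $ 2 $ 2 = 0"
    by (simp_all add: su2_def vec_eq_iff ctranspose_def trace_def sum_2)
  have "Re (A $ 1 $ 1) = 0" "Re (A $ 2 $ 1) = - Re (A $ 1 $ 2)" "Im (A $ 2 $ 1) = Im (A $ 1 $ 2)"
    "Re (A $ 2 $ 2) = 0" "Im (A $ 2 $ 2) = - Im (A $ 1 $ 1)"
    using h[THEN arg_cong[where f = Re]] h[THEN arg_cong[where f = Im]] by simp_all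
  then have "A = su2_vec (vector [2 * Im (A $ 1 $ 2), 2 * Re (A $ 1 $ 2), 2 * Im (A $ 1 $ 1)])"
    by (simp add: mat2_eq_iff su2_vec_components complex_eq_iff)
  then show "A \<in> range su2_vec" by blast
qed

lemma su2_vec_bracket:
  "su2_vec u ** su2_vec v - su2_vec v ** su2_vec u = su2_vec (- cross3 u v)"
  by (simp add: mat2_eq_iff mat2_mult_components su2_vec_components cross3_def complex_eq_iff field_simps)

lemma su2_vec_inner: "- 2 * Re (trace (su2_vec u ** su2_vec v)) = u \<bullet> v"
  by (simp add: trace_def sum_2 mat2_mult_components su2_vec_components inner_vec_def sum_3 field_simps)

lemma su2_vec_axis: "su2_vec (axis k 1) = su2_basis k"
  by (simp add: su2_vec_def axis_def if_distrib[of "\<lambda>x. x *\<^sub>R _"] cong: if_cong)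

section \<open>The group\<close>

lemma scaleR_matrix_mult:
  "(c *\<^sub>R A) ** (B :: mat2) = c *\<^sub>R (A ** B)" "B ** (c *\<^sub>R A) = c *\<^sub>R (B ** A)"
  by (simp_all add: mat2_eq_iff mat2_mult_components scaleR_add_right)

lemma linear_matrix_mult_left: "linear (\<lambda>A :: mat2. (B :: mat2) ** A)"
  by (rule linearI; simp add: mat2_eq_iff mat2_mult_components algebra_simps scaleR_add_right)

lemma linear_matrix_mult_right: "linear (\<lambda>A :: mat2. A ** (B :: mat2))"
  by (rule linearI; simp add: mat2_eq_iff mat2_mult_components algebra_simps scaleR_add_right)

lemma matrix_mult_diff:
  "B ** (A - C) = B ** A - B ** C" for A B C :: mat2
  by (simp add: linear_diff[OF linear_matrix_mult_left])

lemma SU2_one: "mat 1 \<in> SU2"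
  by (simp add: SU2_def mat2_eq_iff mat2_mult_components ctranspose_def) (simp add: mat_def)

lemma SU2_mult:
  assumes "p \<in> SU2" "q \<in> SU2"
  shows "p ** q \<in> SU2"
proof -
  have "ctranspose (p ** q) = ctranspose q ** ctranspose p"
    by (simp add: mat2_eq_iff mat2_mult_components ctranspose_def mult.commute)
  then have "(p ** q) ** ctranspose (p ** q) = p ** (q ** ctranspose q) ** ctranspose p"
    by (simp add: matrix_mul_assoc)
  then show ?thesis using assms by (simp add: SU2_def det_mul)
qed

lemma SU2_inverse:
  assumes "p \<in> SU2"
  shows "matrix_inv p ** p = mat 1" "p ** matrix_inv p = mat 1" "matrix_inv p \<in> SU2"
proof -
  have pc: "p ** ctranspose p = mat 1" using assms by (simp add: SU2_def)
  then have cp: "ctranspose p ** p = mat 1" by (simp add: matrix_left_right_inverse)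
  show "p ** matrix_inv p = mat 1" and 1: "matrix_inv p ** p = mat 1"
    unfolding matrix_inv_def using someI_ex[of "\<lambda>q. p ** q = mat 1 \<and> q ** p = mat 1"] pc cp by blast+
  have "matrix_inv p = matrix_inv p ** (p ** ctranspose p)" by (simp add: pc)
  also have "\<dots> = ctranspose p" by (simp add: matrix_mul_assoc 1)
  finally have eq: "matrix_inv p = ctranspose p" .
  have "det (ctranspose p) = cnj (det p)"
    by (simp add: det_2 ctranspose_def)
  then show "matrix_inv p \<in> SU2"
    using assms cp by (simp add: eq SU2_def) (simp add: ctranspose_def)
qed

lemma tangent_eq: "tangent p = range (\<lambda>v. p ** su2_vec v)"
  unfolding tangent_def range_su2_vec[symmetric] by auto

text \<open>Normalising the affine line through the identity keeps it in the group, because elements of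
  the Lie algebra square to nonpositive multiples of the identity. This gives a curve in every
  tangent direction without the exponential map.\<close>

lemma SU2_curve:
  "(1 / sqrt (1 + t\<^sup>2 * ((norm v)\<^sup>2 / 4))) *\<^sub>R (mat 1 + t *\<^sub>R su2_vec v) \<in> SU2"
proof -
  define n where "n = 1 + t\<^sup>2 * ((norm v)\<^sup>2 / 4)"
  define s where "s = 1 / sqrt n"
  have "n > 0" by (simp add: n_def add_pos_nonneg)
  then have s: "s * s * n = 1" by (simp add: s_def)
  have n: "n = 1 + t * t * (v$1 * v$1 + v$2 * v$2 + v$3 * v$3) / 4"
    unfolding n_def power2_norm_eq_inner by (simp add: inner_vec_def sum_3 power2_eq_square)
  have 1: "s * s * (1 + t * t * (v$1 * v$1 + v$2 * v$2 + v$3 * v$3) / 4) = 1"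
    using s n by simp
  have "s *\<^sub>R (mat 1 + t *\<^sub>R su2_vec v) \<in> SU2"
    unfolding SU2_def using 1
    by (simp add: mat2_eq_iff mat2_mult_components ctranspose_def su2_vec_components det_2
        complex_eq_iff mat_def) (simp add: algebra_simps add_divide_distrib)
  then show ?thesis by (simp add: s_def n_def)
qed

section \<open>Derivatives along the group\<close>

text \<open>The group has empty interior in the space of matrices, so derivatives within it are not unique as
linear maps. Along a curve in the group both candidates are determined by the chain rule.\<close>

lemma has_derivative_within_SU2_unique:
  fixes f :: "mat2 \<Rightarrow> 'b::real_normed_vector"
  assumes p: "p \<in> SU2" and v: "v \<in> tangent p"
    and D: "(f has_derivative D) (at p within SU2)" "(f has_derivative D') (at p within SU2)"
  shows "D v = D' v"
proof -
  obtain u where u: "v = p ** su2_vec u" using v by (auto simp: tangent_eq)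
  define s where "s t = 1 / sqrt (1 + t\<^sup>2 * ((norm u)\<^sup>2 / 4))" for t :: real
  define c where "c t = s t *\<^sub>R (p + t *\<^sub>R v)" for t
  have s: "(s has_field_derivative 0) (at 0)"
    unfolding s_def by (auto intro!: derivative_eq_intros)
  have "((\<lambda>t. p + t *\<^sub>R v) has_vector_derivative v) (at 0)"
    by (auto intro!: derivative_eq_intros)
  from has_vector_derivative_scaleR[OF s this]
  have c: "(c has_derivative (\<lambda>h. h *\<^sub>R v)) (at 0 within UNIV)"
    by (simp add: c_def[abs_def] has_vector_derivative_def s_def)
  have "c t = p ** (s t *\<^sub>R (mat 1 + t *\<^sub>R su2_vec u))" for t
    by (simp add: c_def u scaleR_matrix_mult matrix_add_ldistrib)
  then have im: "range c \<subseteq> SU2"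
    using SU2_curve SU2_mult[OF p] by (auto simp: s_def)
  have c0: "c 0 = p" by (simp add: c_def s_def)
  have "(f \<circ> c has_derivative D \<circ> (\<lambda>h. h *\<^sub>R v)) (at 0)"
    "(f \<circ> c has_derivative D' \<circ> (\<lambda>h. h *\<^sub>R v)) (at 0)"
    using D by (auto intro!: diff_chain_within[OF c, simplified] has_derivative_subset[OF _ im] simp: c0)
  from has_derivative_unique[OF this] have "(D \<circ> (\<lambda>h. h *\<^sub>R v)) 1 = (D' \<circ> (\<lambda>h. h *\<^sub>R v)) 1"
    by simp
  then show ?thesis by simp
qed

text \<open>\<open>dir_deriv\<close> picks some derivative within the group; its value on tangent vectors does not depend on
that choice.\<close>

lemma dir_deriv_eq:
  assumes "p \<in> SU2" "v \<in> tangent p" "(f has_derivative D) (at p within SU2)"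
  shows "dir_deriv f p v = D v"
  unfolding dir_deriv_def
  using assms has_derivative_within_SU2_unique frechet_derivative_works differentiableI by metis

text \<open>The hypothesis concerns points of the group only: covariant derivatives and brackets of left-invariant
fields are left-invariant there, but their values elsewhere carry no information.\<close>

lemma dir_deriv_const:
  assumes "p \<in> SU2" "v \<in> tangent p" "\<And>q. q \<in> SU2 \<Longrightarrow> f q = c"
  shows "dir_deriv f p v = 0"
proof -
  have "(f has_derivative (\<lambda>_. 0)) (at p within SU2)"
    by (rule has_derivative_transform[OF assms(1) assms(3) has_derivative_const])
  then show ?thesis using dir_deriv_eq assms by blast
qed

lemma dir_deriv_left_field:
  fixes A :: mat2
  assumes "p \<in> SU2" "v \<in> tangent p" "\<And>q. q \<in> SU2 \<Longrightarrow> X q = q ** A"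
  shows "dir_deriv X p v = v ** A"
proof -
  have "((\<lambda>q. q ** A) has_derivative (\<lambda>q. q ** A)) (at p within SU2)"
    by (intro bounded_linear_imp_has_derivative linear_conv_bounded_linear[THEN iffD1, OF linear_matrix_mult_right])
  then have "(X has_derivative (\<lambda>q. q ** A)) (at p within SU2)"
    by (rule has_derivative_transform[OF assms(1), rotated]) (rule assms(3))
  then show ?thesis using dir_deriv_eq assms by blast
qed

section \<open>Orthonormal frames of the Lie algebra\<close>

text \<open>The coordinate maps of positively oriented bi-invariantly orthonormal bases. Only rotations are
admitted, because the bracket formula below changes sign under reflections.\<close>

definition su2_frame :: "(real^3 \<Rightarrow> mat2) \<Rightarrow> bool" where
  "su2_frame F \<longleftrightarrow> (\<exists>R. rotation_matrix R \<and> F = (\<lambda>v. su2_vec (R *v v)))"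

lemma rotation_transpose:
  assumes "rotation_matrix R"
  shows "R *v (transpose R *v v) = v" "transpose R *v (R *v v) = v"
  using assms unfolding rotation_matrix_def orthogonal_matrix_def
  by (simp_all add: matrix_vector_mul_assoc del: vector_transpose_matrix transpose_matrix_vector)

lemma rotation_inner:
  fixes R :: "real^'n^'n"
  assumes "rotation_matrix R" shows "(R *v u) \<bullet> (R *v v) = u \<bullet> v"
proof -
  have "(R *v u) \<bullet> (R *v v) = (transpose R *v (R *v u)) \<bullet> v"
    by (simp only: transpose_matrix_vector dot_lmul_matrix)
  then show ?thesis by (simp only: rotation_transpose[OF assms])
qed

lemma
  assumes "su2_frame F"
  shows su2_frame_linear: "linear F"
    and su2_frame_range: "range F = su2"
    and su2_frame_bracket: "F u ** F v - F v ** F u = F (- cross3 u v)"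
    and su2_frame_inner: "- 2 * Re (trace (F u ** F v)) = u \<bullet> v"
proof -
  obtain R where R: "rotation_matrix R" and F: "F = (\<lambda>v. su2_vec (R *v v))"
    using assms by (auto simp: su2_frame_def)
  show "linear F"
    unfolding F using linear_compose[OF matrix_vector_mul_linear linear_su2_vec] by (simp add: o_def)
  have "surj (\<lambda>v. R *v v)" using rotation_transpose[OF R] by (metis surjI)
  then have "range F = range su2_vec" unfolding F by (metis (no_types) image_image)
  then show "range F = su2" by (simp add: range_su2_vec)
  show "F u ** F v - F v ** F u = F (- cross3 u v)"
    unfolding F su2_vec_bracket cross_rotation_matrix[OF R]
    by (simp add: linear_neg[OF matrix_vector_mul_linear])
  show "- 2 * Re (trace (F u ** F v)) = u \<bullet> v"
    unfolding F su2_vec_inner by (rule rotation_inner[OF R])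
qed

lemma su2_frame_inj:
  assumes "su2_frame F" shows "F u = F v \<longleftrightarrow> u = v"
proof
  assume "F u = F v"
  then have "u \<bullet> w = v \<bullet> w" for w using su2_frame_inner[OF assms] by metis
  then show "u = v" by (metis vector_eq_rdot)
qed simp

lemma tangent_frame:
  assumes "su2_frame F" shows "tangent p = range (\<lambda>v. p ** F v)"
  unfolding tangent_def su2_frame_range[OF assms, symmetric] by auto

lemma left_translate_inj:
  assumes "p \<in> SU2" shows "p ** A = p ** B \<longleftrightarrow> A = B"
  by (metis SU2_inverse(1)[OF assms] matrix_mul_assoc matrix_mul_lid)

lemma g0_frame:
  assumes "su2_frame F" "p \<in> SU2"
  shows "g0 p (p ** F u) (p ** F v) = u \<bullet> v"
proof -
  have "matrix_inv p ** (p ** A) = A" for A :: mat2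
    by (simp add: matrix_mul_assoc SU2_inverse[OF assms(2)])
  then have "g0 p (p ** F u) (p ** F v) = - 2 * Re (trace (F u ** F v))"
    using assms(2) tangent_frame[OF assms(1)] by (simp add: g0_def)
  then show ?thesis unfolding su2_frame_inner[OF assms(1)] .
qed

text \<open>Changing the reference basis to the frame conjugates the matrix by a rotation, so traces and
determinants may be computed in the frame that suits the metric.\<close>

lemma endo_matrix_similar:
  assumes F: "su2_frame F" and p: "p \<in> SU2" and h: "linear h"
    and L: "\<And>v. L (p ** F v) = p ** F (h v)"
  shows "trace (endo_matrix p L) = trace (matrix h)" "det (endo_matrix p L) = det (matrix h)"
proof -
  obtain R where R: "rotation_matrix R" and FR: "F = (\<lambda>v. su2_vec (R *v v))"
    using F by (auto simp: su2_frame_def)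
  have RR: "transpose R ** R = mat 1" "R ** transpose R = mat 1"
    using R by (simp_all add: rotation_matrix_def orthogonal_matrix_def)
  have basis: "su2_basis k = F (transpose R *v axis k 1)" for k
    unfolding FR rotation_transpose[OF R] su2_vec_axis ..
  have "endo_matrix p L $ i $ j = (R ** matrix h ** transpose R) $ i $ j" for i j
  proof -
    have "endo_matrix p L $ i $ j = h (transpose R *v axis j 1) \<bullet> (transpose R *v axis i 1)"
      unfolding endo_matrix_def basis L by (simp add: g0_frame[OF F p])
    also have "\<dots> = (R *v h (transpose R *v axis j 1)) $ i"
      by (metis dot_lmul_matrix inner_commute vector_transpose_matrix cart_eq_inner_axis)
    also have "\<dots> = (R *v (matrix h *v (transpose R *v axis j 1))) $ i"
      using h by (simp add: matrix_works)
    also have "\<dots> = (R ** matrix h ** transpose R) $ i $ j"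
      unfolding matrix_vector_mul_assoc matrix_vector_mult_basis column_def
      by (simp add: matrix_vector_mult_def matrix_matrix_mult_def[of _ "transpose R"])
    finally show ?thesis .
  qed
  then have eq: "endo_matrix p L = R ** matrix h ** transpose R" by (simp add: vec_eq_iff)
  have "trace (R ** matrix h ** transpose R) = trace (transpose R ** (R ** matrix h))"
    by (rule trace_mul_sym)
  also have "\<dots> = trace (matrix h)" by (simp add: matrix_mul_assoc RR)
  finally show "trace (endo_matrix p L) = trace (matrix h)" by (simp add: eq)
  show "det (endo_matrix p L) = det (matrix h)"
    using R by (simp add: eq det_mul rotation_matrix_def)
qed

section \<open>Curvature of a diagonal metric\<close>

definition diag_map :: "real^3 \<Rightarrow> real^3 \<Rightarrow> real^3" where
  "diag_map d u = (\<chi> i. d $ i * u $ i)"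

lemma linear_diag_map: "linear (diag_map d)"
  by (rule linearI) (simp_all add: diag_map_def vec_eq_iff algebra_simps)

lemma trace_diag_map: "trace (matrix (diag_map d)) = d $ 1 + d $ 2 + d $ 3"
  by (simp add: trace_def sum_3 matrix_def diag_map_def axis_def)

lemma det_diag_map: "det (matrix (diag_map d)) = d $ 1 * d $ 2 * d $ 3"
  by (simp add: det_3 matrix_def diag_map_def axis_def)

text \<open>The Levi-Civita connection on left-invariant fields in frame coordinates. With
\<open>m\<^sub>j = l\<^sub>1 + l\<^sub>2 + l\<^sub>3 - 2 l\<^sub>j\<close>, this says that \<open>\<nabla>\<close> of the \<open>i\<close>-th and \<open>j\<close>-th frame vectors is
\<open>-\<epsilon>\<^sub>i\<^sub>j\<^sub>k m\<^sub>i / (2 l\<^sub>k)\<close> times the \<open>k\<close>-th.\<close>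

definition nabla :: "real^3 \<Rightarrow> real^3 \<Rightarrow> real^3 \<Rightarrow> real^3" where
  "nabla l u v = (\<chi> i. - cross3 (diag_map (\<chi> j. l $ 1 + l $ 2 + l $ 3 - 2 * l $ j) u) v $ i / (2 * l $ i))"

lemma nabla_add_left: "nabla l (u + u') v = nabla l u v + nabla l u' v"
  and nabla_scale_left: "nabla l (c *\<^sub>R u) v = c *\<^sub>R nabla l u v"
  and nabla_add_right: "nabla l u (v + v') = nabla l u v + nabla l u v'"
  and nabla_scale_right: "nabla l u (c *\<^sub>R v) = c *\<^sub>R nabla l u v"
  by (simp_all add: nabla_def linear_add[OF linear_diag_map] linear_scale[OF linear_diag_map]
      cross_add_left cross_add_right cross_mult_left cross_mult_right vec_eq_iff add_divide_distrib
      diff_divide_distrib)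

lemma nabla_minus_left: "nabla l (- u) v = - nabla l u v"
  using nabla_scale_left[of l "- 1" u v] by simp

definition curvature_op :: "real^3 \<Rightarrow> real^3 \<Rightarrow> real^3 \<Rightarrow> real^3 \<Rightarrow> real^3" where
  "curvature_op l u v w =
     nabla l u (nabla l v w) - nabla l v (nabla l u w) - nabla l (- cross3 u v) w"

lemma linear_curvature_op: "linear (\<lambda>u. curvature_op l u v w)"
proof (rule linearI)
  show "curvature_op l (x + y) v w = curvature_op l x v w + curvature_op l y v w" for x y
    by (simp add: curvature_op_def nabla_add_left nabla_add_right nabla_minus_left cross_add_left
        del: minus_add_distrib)
  show "curvature_op l (c *\<^sub>R x) v w = c *\<^sub>R curvature_op l x v w" for c x
    by (simp add: curvature_op_def nabla_scale_left nabla_scale_right nabla_minus_left cross_mult_left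
        scaleR_diff_right scaleR_add_right)
qed

text \<open>The entries of the Ricci form in the frame, in Milnor's product form. The form is already diagonal.\<close>

definition ricci_coeffs :: "real^3 \<Rightarrow> real^3" where
  "ricci_coeffs l = (let m = (\<lambda>i. l $ 1 + l $ 2 + l $ 3 - 2 * l $ i) in
     vector [m 2 * m 3 / (2 * l $ 2 * l $ 3), m 3 * m 1 / (2 * l $ 3 * l $ 1), m 1 * m 2 / (2 * l $ 1 * l $ 2)])"

definition sec_curv_vec :: "real^3 \<Rightarrow> real^3" where
  "sec_curv_vec l = vector [sec_curv (l $ 1) (l $ 2) (l $ 3), sec_curv (l $ 2) (l $ 3) (l $ 1), sec_curv (l $ 3) (l $ 1) (l $ 2)]"

definition cross_eigenvalues :: "real^3 \<Rightarrow> real^3" where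
  "cross_eigenvalues l = vector [cross_eigenvalue (l $ 1) (l $ 2) (l $ 3),
     cross_eigenvalue (l $ 2) (l $ 3) (l $ 1), cross_eigenvalue (l $ 3) (l $ 1) (l $ 2)]"

text \<open>The right-hand side is the Koszul formula for left-invariant fields, where only the three bracket terms
survive.\<close>

lemma nabla_koszul:
  assumes "\<And>i. l $ i > 0"
  shows "2 * diag_form l (nabla l u v) w
    = diag_form l (- cross3 u v) w - diag_form l (- cross3 u w) v - diag_form l (- cross3 v w) u"
proof -
  have "l $ 1 > 0" "l $ 2 > 0" "l $ 3 > 0" using assms by auto
  then have "2 * diag_form l (nabla l u v) w
    = - (cross3 (diag_map (\<chi> j. l $ 1 + l $ 2 + l $ 3 - 2 * l $ j) u) v \<bullet> w)"
    by (simp add: diag_form_3 nabla_def inner_vec_def sum_3)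
  also have "\<dots> = diag_form l (- cross3 u v) w - diag_form l (- cross3 u w) v - diag_form l (- cross3 v w) u"
    by (simp add: diag_form_3 cross3_def diag_map_def inner_vec_def sum_3 algebra_simps)
  finally show ?thesis .
qed

text \<open>The Ricci form is the sum of three diagonal entries of the curvature. Each entry contributes to two of
the coefficients of \<open>u\<^sub>i v\<^sub>i\<close>, and the two contributions to a coefficient combine to a single product,
since \<open>2 a = q + r\<close>, \<open>2 b = r + p\<close>, \<open>2 c = p + q\<close>.\<close>

lemma trace_curvature_op:
  assumes "\<And>i. l $ i > 0"
  shows "trace (matrix (\<lambda>w. curvature_op l w u v)) = diag_form (ricci_coeffs l) u v"
proof -
  define a b c where l: "a = l $ 1" "b = l $ 2" "c = l $ 3"
  define p q r where m: "p = b + c - a" "q = c + a - b" "r = a + b - c"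
  have pos: "a > 0" "b > 0" "c > 0" using assms by (auto simp: l)
  have mil: "l $ 1 + l $ 2 + l $ 3 - 2 * l $ 1 = p" "l $ 1 + l $ 2 + l $ 3 - 2 * l $ 2 = q"
    "l $ 1 + l $ 2 + l $ 3 - 2 * l $ 3 = r"
    by (simp_all add: l m)
  have mil': "a + b + c - 2 * a = p" "a + b + c - 2 * b = q" "a + b + c - 2 * c = r"
    by (simp_all add: m)
  have nab: "nabla l x y $ 1 = (r * x $ 3 * y $ 2 - q * x $ 2 * y $ 3) / (2 * a)"
    "nabla l x y $ 2 = (p * x $ 1 * y $ 3 - r * x $ 3 * y $ 1) / (2 * b)"
    "nabla l x y $ 3 = (q * x $ 2 * y $ 1 - p * x $ 1 * y $ 2) / (2 * c)" for x y
    by (simp_all only: nabla_def vec_lambda_beta cross3_def vector_3 diag_map_def l[symmetric] mil')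
      (simp_all add: mult_ac)
  have 1: "curvature_op l (axis 1 1) u v $ 1
    = (r / (2 * a) - p * q / (4 * a * c)) * u $ 2 * v $ 2 + (q / (2 * a) - p * r / (4 * a * b)) * u $ 3 * v $ 3"
    using pos by (simp add: curvature_op_def nab axis_def cross3_def field_simps)
  have 2: "curvature_op l (axis 2 1) u v $ 2
    = (p / (2 * b) - q * r / (4 * b * a)) * u $ 3 * v $ 3 + (r / (2 * b) - q * p / (4 * b * c)) * u $ 1 * v $ 1"
    using pos by (simp add: curvature_op_def nab axis_def cross3_def field_simps)
  have 3: "curvature_op l (axis 3 1) u v $ 3
    = (q / (2 * c) - r * p / (4 * c * b)) * u $ 1 * v $ 1 + (p / (2 * c) - r * q / (4 * c * a)) * u $ 2 * v $ 2"
    using pos by (simp add: curvature_op_def nab axis_def cross3_def field_simps)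
  have coeff: "(r' / (2 * b') - q' * p' / (4 * b' * c')) + (q' / (2 * c') - r' * p' / (4 * c' * b'))
      = q' * r' / (2 * b' * c')"
    if "b' = (p' + r') / 2" "c' = (p' + q') / 2" "b' > 0" "c' > 0" for b' c' p' q' r' :: real
  proof -
    have "(r' / (2 * b') - q' * p' / (4 * b' * c')) + (q' / (2 * c') - r' * p' / (4 * c' * b'))
      = (2 * c' * r' + 2 * b' * q' - q' * p' - r' * p') / (4 * b' * c')"
      using that(3,4) by (simp add: field_simps)
    also have "2 * c' * r' + 2 * b' * q' - q' * p' - r' * p' = 2 * (q' * r')"
      using that(1,2) by (simp add: algebra_simps)
    finally show ?thesis by simp
  qed
  have abc: "a = (q + r) / 2" "b = (r + p) / 2" "c = (p + q) / 2"
    by (simp_all add: m)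
  have "trace (matrix (\<lambda>w. curvature_op l w u v))
    = ((r / (2 * b) - q * p / (4 * b * c)) + (q / (2 * c) - r * p / (4 * c * b))) * (u $ 1 * v $ 1)
    + ((p / (2 * c) - r * q / (4 * c * a)) + (r / (2 * a) - p * q / (4 * a * c))) * (u $ 2 * v $ 2)
    + ((q / (2 * a) - p * r / (4 * a * b)) + (p / (2 * b) - q * r / (4 * b * a))) * (u $ 3 * v $ 3)"
    by (simp add: trace_def sum_3 matrix_def 1 2 3) (simp add: algebra_simps)
  also have "\<dots> = q * r / (2 * b * c) * (u $ 1 * v $ 1) + r * p / (2 * c * a) * (u $ 2 * v $ 2)
      + p * q / (2 * a * b) * (u $ 3 * v $ 3)"
    using coeff[of b p r c q] coeff[of c q p a r] coeff[of a r q b p] abc pos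
    by (simp only: add.commute)
  also have "\<dots> = diag_form (ricci_coeffs l) u v"
    by (simp add: diag_form_3 ricci_coeffs_def Let_def mil) (simp add: l)
  finally show ?thesis .
qed

text \<open>With \<open>p, q, r\<close> as below, the Ricci eigenvalues are \<open>q r\<close>, \<open>r p\<close>, \<open>p q\<close> over \<open>2 l\<^sub>1 l\<^sub>2 l\<^sub>3\<close>. Subtracting
half of their sum from the first gives \<open>q r - p q - p r\<close> over \<open>4 l\<^sub>1 l\<^sub>2 l\<^sub>3\<close>, which is minus a
sectional curvature; the other two are cyclic.\<close>

lemma einstein_coeffs:
  assumes "\<And>i. l $ i > 0"
  shows "ricci_coeffs l $ i / l $ i - 1 / 2 * (\<Sum>j\<in>UNIV. ricci_coeffs l $ j / l $ j) = - sec_curv_vec l $ i"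
proof -
  have pos: "l $ 1 > 0" "l $ 2 > 0" "l $ 3 > 0" using assms by auto
  define a b c where l: "a = l $ 1" "b = l $ 2" "c = l $ 3"
  define p q r where m: "p = b + c - a" "q = c + a - b" "r = a + b - c"
  define D where "D = 2 * (a * b * c)"
  have D: "D > 0" using pos by (simp add: D_def l)
  have mil: "l $ 1 + l $ 2 + l $ 3 - 2 * l $ 1 = p" "l $ 1 + l $ 2 + l $ 3 - 2 * l $ 2 = q"
    "l $ 1 + l $ 2 + l $ 3 - 2 * l $ 3 = r"
    by (simp_all add: l m)
  have ric: "ricci_coeffs l $ 1 / l $ 1 = q * r / D" "ricci_coeffs l $ 2 / l $ 2 = r * p / D"
    "ricci_coeffs l $ 3 / l $ 3 = p * q / D"
    by (simp_all add: ricci_coeffs_def Let_def mil) (simp_all add: D_def l mult_ac)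
  have num: "(b - c)\<^sup>2 + 2 * a * (b + c) - 3 * a\<^sup>2 = p * q + p * r - q * r"
    "(c - a)\<^sup>2 + 2 * b * (c + a) - 3 * b\<^sup>2 = q * r + q * p - r * p"
    "(a - b)\<^sup>2 + 2 * c * (a + b) - 3 * c\<^sup>2 = r * p + r * q - p * q"
    unfolding m by algebra+
  have "4 * a * b * c = 2 * D" "4 * b * c * a = 2 * D" "4 * c * a * b = 2 * D"
    by (simp_all add: D_def)
  then have "sec_curv_vec l $ 1 = (p * q + p * r - q * r) / (2 * D)"
    "sec_curv_vec l $ 2 = (q * r + q * p - r * p) / (2 * D)"
    "sec_curv_vec l $ 3 = (r * p + r * q - p * q) / (2 * D)"
    by (simp_all add: sec_curv_vec_def sec_curv_def l[symmetric] num)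
  then have "\<forall>i. ricci_coeffs l $ i / l $ i - 1 / 2 * (\<Sum>j\<in>UNIV. ricci_coeffs l $ j / l $ j) = - sec_curv_vec l $ i"
    using D by (simp add: forall_3 sum_3 ric) (simp add: field_simps)
  then show ?thesis by blast
qed

text \<open>A left-invariant metric together with a frame in which it is diagonal; all curvature computations take
place in these coordinates.\<close>

locale framed_metric =
  fixes F :: "real^3 \<Rightarrow> mat2" and l :: "real^3" and g :: tensor02
  assumes frame: "su2_frame F"
    and l_pos: "l $ i > 0"
    and metric: "left_invariant_metric g"
    and diagonal: "g (mat 1) (F u) (F v) = diag_form l u v"
begin

lemmas tangent = tangent_frame[OF frame]
lemmas F_linear = su2_frame_linear[OF frame]

lemma frame_tangent: "p ** F u \<in> tangent p"
  by (simp add: tangent)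

lemma metric_frame: "p \<in> SU2 \<Longrightarrow> g p (p ** F u) (p ** F v) = diag_form l u v"
  using metric frame_tangent[of "mat 1"] SU2_one diagonal[of u v]
  unfolding left_invariant_metric_def left_invariant_def by (metis matrix_mul_rid matrix_mul_lid)

lemma diag_form_nondegenerate:
  assumes "\<And>w. diag_form l u w = diag_form l v w" shows "u = v"
proof -
  have "u $ i = v $ i" for i
    using assms[of "axis i 1"] l_pos[of i] exhaust_3[of i] by (auto simp: diag_form_3 axis_def)
  then show ?thesis by (simp add: vec_eq_iff)
qed

text \<open>Both the connection and the raised index are defined as the vector that represents a linear form; in
coordinates such a vector is unique because all eigenvalues are positive.\<close>

lemma represents_unique:
  assumes "p \<in> SU2" "\<And>w. diag_form l x w = h w"
  shows "(THE w. w \<in> tangent p \<and> (\<forall>v. g p w (p ** F v) = h v)) = p ** F x"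
proof (rule the_equality)
  show "p ** F x \<in> tangent p \<and> (\<forall>v. g p (p ** F x) (p ** F v) = h v)"
    using assms by (simp add: frame_tangent metric_frame)
  fix w assume w: "w \<in> tangent p \<and> (\<forall>v. g p w (p ** F v) = h v)"
  then obtain y where y: "w = p ** F y" by (auto simp: tangent)
  then have "diag_form l y v = diag_form l x v" for v
    using w assms metric_frame by metis
  then show "w = p ** F x" using diag_form_nondegenerate y by blast
qed

lemma lie_bracket_left:
  assumes "\<And>q. q \<in> SU2 \<Longrightarrow> X q = q ** F u" "\<And>q. q \<in> SU2 \<Longrightarrow> Y q = q ** F v" "p \<in> SU2"
  shows "lie_bracket X Y p = p ** F (- cross3 u v)"
proof -
  have "lie_bracket X Y p = (p ** F u) ** F v - (p ** F v) ** F u"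
    using dir_deriv_left_field[OF assms(3) frame_tangent assms(1)]
      dir_deriv_left_field[OF assms(3) frame_tangent assms(2)] assms(1,2)[OF assms(3)]
    by (simp add: lie_bracket_def)
  also have "\<dots> = p ** (F u ** F v - F v ** F u)"
    by (simp add: matrix_mult_diff matrix_mul_assoc)
  finally show ?thesis by (simp only: su2_frame_bracket[OF frame])
qed

lemma koszul_left:
  assumes "\<And>q. q \<in> SU2 \<Longrightarrow> X q = q ** F u" "\<And>q. q \<in> SU2 \<Longrightarrow> Y q = q ** F v"
    "\<And>q. q \<in> SU2 \<Longrightarrow> Z q = q ** F w" "p \<in> SU2"
  shows "koszul g X Y Z p
    = diag_form l (- cross3 u v) w - diag_form l (- cross3 u w) v - diag_form l (- cross3 v w) u"
proof -
  have const: "dir_deriv (\<lambda>q. g q (A q) (B q)) p (p ** F x) = 0"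
    if "\<And>q. q \<in> SU2 \<Longrightarrow> A q = q ** F a" "\<And>q. q \<in> SU2 \<Longrightarrow> B q = q ** F b" for A B a b x
    by (rule dir_deriv_const[OF assms(4) frame_tangent, of _ "diag_form l a b"])
      (simp add: that metric_frame)
  show ?thesis
    unfolding koszul_def assms(1-3)[OF assms(4)]
    by (simp only: const[OF assms(2,3)] const[OF assms(1,3)] const[OF assms(1,2)]
        lie_bracket_left[OF assms(1,2,4)] lie_bracket_left[OF assms(1,3,4)]
        lie_bracket_left[OF assms(2,3,4)] add_0 diff_0_right metric_frame[OF assms(4)])
qed

lemma levi_civita_left:
  assumes "\<And>q. q \<in> SU2 \<Longrightarrow> X q = q ** F u" "\<And>q. q \<in> SU2 \<Longrightarrow> Y q = q ** F v" "p \<in> SU2"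
  shows "levi_civita g X Y p = p ** F (nabla l u v)"
proof -
  have "levi_civita g X Y p = (THE w. w \<in> tangent p \<and> (\<forall>c. g p w (p ** F c) =
    (diag_form l (- cross3 u v) c - diag_form l (- cross3 u c) v - diag_form l (- cross3 v c) u) / 2))"
    unfolding levi_civita_def su2_frame_range[OF frame, symmetric]
    by (simp add: koszul_left[OF assms(1,2) _ assms(3)]) (simp add: eq_divide_eq mult.commute)
  also have "\<dots> = p ** F (nabla l u v)"
    by (rule represents_unique[OF assms(3)]) (simp add: nabla_koszul[OF l_pos, symmetric])
  finally show ?thesis .
qed

lemma riemann_left:
  assumes "\<And>q. q \<in> SU2 \<Longrightarrow> X q = q ** F u" "\<And>q. q \<in> SU2 \<Longrightarrow> Y q = q ** F v"
    "\<And>q. q \<in> SU2 \<Longrightarrow> Z q = q ** F w" "p \<in> SU2"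
  shows "riemann g X Y Z p = p ** F (curvature_op l u v w)"
  unfolding riemann_def curvature_op_def
  by (simp add: levi_civita_left assms lie_bracket_left linear_diff[OF F_linear] matrix_mult_diff)

lemma left_extension_frame:
  assumes "p \<in> SU2" shows "left_extension p (p ** F u) q = q ** F u"
  using SU2_inverse(1)[OF assms] by (simp add: left_extension_def matrix_mul_assoc)

lemma ricci_frame:
  assumes p: "p \<in> SU2"
  shows "ricci g p (p ** F u) (p ** F v) = diag_form (ricci_coeffs l) u v"
proof -
  have "riemann g (left_extension p (p ** F w)) (left_extension p (p ** F u)) (left_extension p (p ** F v)) p
    = p ** F (curvature_op l w u v)" for w
    by (rule riemann_left) (simp_all add: left_extension_frame p)
  then have "ricci g p (p ** F u) (p ** F v) = trace (matrix (\<lambda>w. curvature_op l w u v))"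
    unfolding ricci_def by (rule endo_matrix_similar(1)[OF frame p linear_curvature_op])
  then show ?thesis by (simp only: trace_curvature_op[OF l_pos])
qed

lemma raise_index_frame:
  assumes p: "p \<in> SU2" and h: "\<And>u v. h p (p ** F u) (p ** F v) = diag_form r u v"
  shows "raise_index g h p (p ** F u) = p ** F (diag_map (\<chi> i. r $ i / l $ i) u)"
proof -
  have "raise_index g h p (p ** F u) = (THE w. w \<in> tangent p \<and> (\<forall>v. g p w (p ** F v) = diag_form r u v))"
    unfolding raise_index_def by (simp add: tangent h)
  also have "\<dots> = p ** F (diag_map (\<chi> i. r $ i / l $ i) u)"
    using l_pos by (intro represents_unique p) (simp add: diag_form_def diag_map_def less_imp_neq[symmetric])
  finally show ?thesis .
qed

lemma scalar_curvature_eq: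
  assumes p: "p \<in> SU2"
  shows "scalar_curvature g p = (\<Sum>i\<in>UNIV. ricci_coeffs l $ i / l $ i)"
proof -
  have "trace (endo_matrix p (raise_index g (ricci g) p))
    = trace (matrix (diag_map (\<chi> i. ricci_coeffs l $ i / l $ i)))"
    by (rule endo_matrix_similar(1)[OF frame p linear_diag_map])
      (rule raise_index_frame[where h = "ricci g", OF p ricci_frame[OF p]])
  then show ?thesis by (simp add: scalar_curvature_def trace_diag_map sum_3)
qed

lemma einstein_frame:
  assumes p: "p \<in> SU2"
  shows "einstein_endo g p (p ** F u) = p ** F (diag_map (- sec_curv_vec l) u)"
proof -
  define S where "S = (\<Sum>i\<in>UNIV. ricci_coeffs l $ i / l $ i)"
  have "einstein_endo g p (p ** F u)
    = p ** F (diag_map (\<chi> i. (ricci_coeffs l - (1 / 2 * S) *\<^sub>R l) $ i / l $ i) u)"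
    unfolding einstein_endo_def
  proof (rule raise_index_frame[OF p])
    show "ricci g p (p ** F u) (p ** F v) - 1 / 2 * scalar_curvature g p * g p (p ** F u) (p ** F v)
      = diag_form (ricci_coeffs l - (1 / 2 * S) *\<^sub>R l) u v" for u v
      unfolding ricci_frame[OF p] metric_frame[OF p] scalar_curvature_eq[OF p] S_def[symmetric]
      by (simp add: diag_form_3 algebra_simps)
  qed
  moreover have "(\<chi> i. (ricci_coeffs l - (1 / 2 * S) *\<^sub>R l) $ i / l $ i) = - sec_curv_vec l"
  proof (simp only: vec_eq_iff, rule allI)
    fix i
    have "(ricci_coeffs l - (1 / 2 * S) *\<^sub>R l) $ i / l $ i = ricci_coeffs l $ i / l $ i - 1 / 2 * S"
      using l_pos[of i] by (simp add: field_simps)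
    then show "(\<chi> i. (ricci_coeffs l - (1 / 2 * S) *\<^sub>R l) $ i / l $ i) $ i = (- sec_curv_vec l) $ i"
      using einstein_coeffs[of l i, OF l_pos] by (simp add: S_def)
  qed
  ultimately show ?thesis by simp
qed

lemma einstein_bij_iff:
  assumes p: "p \<in> SU2"
  shows "bij_betw (einstein_endo g p) (tangent p) (tangent p) \<longleftrightarrow> (\<forall>i. sec_curv_vec l $ i \<noteq> 0)"
proof
  assume "bij_betw (einstein_endo g p) (tangent p) (tangent p)"
  then have inj: "inj_on (einstein_endo g p) (tangent p)" by (rule bij_betw_imp_inj_on)
  show "\<forall>i. sec_curv_vec l $ i \<noteq> 0"
  proof (intro allI notI)
    fix i assume "sec_curv_vec l $ i = 0"
    then have "diag_map (- sec_curv_vec l) (axis i 1) = diag_map (- sec_curv_vec l) 0"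
      by (simp add: diag_map_def vec_eq_iff axis_def)
    then have "einstein_endo g p (p ** F (axis i 1)) = einstein_endo g p (p ** F 0)"
      by (simp add: einstein_frame[OF p])
    then have "p ** F (axis i 1) = p ** F 0"
      using inj frame_tangent by (metis inj_onD)
    then show False
      by (simp add: left_translate_inj[OF p] su2_frame_inj[OF frame] axis_eq_0_iff)
  qed
next
  assume nz: "\<forall>i. sec_curv_vec l $ i \<noteq> 0"
  let ?d = "\<chi> i. - 1 / sec_curv_vec l $ i"
  have inv: "diag_map (- sec_curv_vec l) (diag_map ?d u) = u" "diag_map ?d (diag_map (- sec_curv_vec l) u) = u" for u
    using nz by (simp_all add: diag_map_def vec_eq_iff)
  show "bij_betw (einstein_endo g p) (tangent p) (tangent p)"
    unfolding bij_betw_def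
  proof
    show "inj_on (einstein_endo g p) (tangent p)"
      using inv(2) by (auto simp: inj_on_def tangent einstein_frame[OF p] left_translate_inj[OF p]
          su2_frame_inj[OF frame]) metis
    show "einstein_endo g p ` tangent p = tangent p"
      using inv(1) by (auto simp: tangent einstein_frame[OF p] image_iff) metis
  qed
qed

lemma cross_curvature_frame:
  assumes p: "p \<in> SU2" and nz: "\<And>i. sec_curv_vec l $ i \<noteq> 0"
  shows "cross_curvature g p (p ** F u) (p ** F v) = diag_form (cross_eigenvalues l) u v"
proof -
  let ?d = "\<chi> i. - 1 / sec_curv_vec l $ i"
  have "einstein_endo g p (p ** F (diag_map ?d u)) = p ** F u"
  proof -
    have "diag_map (- sec_curv_vec l) (diag_map ?d u) = u"
      using nz by (simp add: diag_map_def vec_eq_iff)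
    then show ?thesis by (simp add: einstein_frame[OF p])
  qed
  moreover have "inj_on (einstein_endo g p) (tangent p)"
    using einstein_bij_iff[OF p] nz by (auto dest: bij_betw_imp_inj_on)
  ultimately have inv: "inv_into (tangent p) (einstein_endo g p) (p ** F u) = p ** F (diag_map ?d u)"
    using frame_tangent by (metis inv_into_f_f)
  have "det (endo_matrix p (einstein_endo g p)) = det (matrix (diag_map (- sec_curv_vec l)))"
    by (rule endo_matrix_similar(2)[OF frame p linear_diag_map]) (rule einstein_frame[OF p])
  then have det: "det (endo_matrix p (einstein_endo g p)) = - (sec_curv_vec l $ 1 * sec_curv_vec l $ 2 * sec_curv_vec l $ 3)"
    by (simp add: det_diag_map)
  have "cross_curvature g p (p ** F u) (p ** F v)
    = - (sec_curv_vec l $ 1 * sec_curv_vec l $ 2 * sec_curv_vec l $ 3) * diag_form l (diag_map ?d u) v"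
    by (simp only: cross_curvature_def inv det metric_frame[OF p])
  also have "\<dots> = diag_form (cross_eigenvalues l) u v"
    using nz[of 1] nz[of 2] nz[of 3]
    by (simp add: diag_form_3 diag_map_def cross_eigenvalues_def cross_eigenvalue_def sec_curv_vec_def field_simps)
  finally show ?thesis .
qed

text \<open>The reduction of the curvature equation to eigenvalues: solutions are diagonal in the same frame as
their cross curvature.\<close>

lemma has_cross_curvature_iff:
  "has_cross_curvature g Y \<longleftrightarrow> (\<forall>i. sec_curv_vec l $ i \<noteq> 0) \<and>
     (\<forall>p\<in>SU2. \<forall>u v. Y p (p ** F u) (p ** F v) = diag_form (cross_eigenvalues l) u v)"
  (is "_ \<longleftrightarrow> ?nz \<and> ?eq")
proof -
  have "(\<forall>p\<in>SU2. bij_betw (einstein_endo g p) (tangent p) (tangent p)) \<longleftrightarrow> ?nz"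
    using einstein_bij_iff SU2_one by blast
  moreover have "(\<forall>p\<in>SU2. \<forall>u\<in>tangent p. \<forall>v\<in>tangent p. cross_curvature g p u v = Y p u v) \<longleftrightarrow> ?eq"
    if ?nz
    using cross_curvature_frame that by (simp add: tangent) metis
  ultimately show ?thesis unfolding has_cross_curvature_def by blast
qed

end

section \<open>Left-invariant metrics and their frames\<close>

text \<open>Every left-invariant metric is determined at the identity, where it is a symmetric form on
three-space and can be diagonalised by a rotation.\<close>

lemma framed_metric_exists:
  assumes g: "left_invariant_metric g"
  obtains F l where "framed_metric F l g" "l $ 1 \<ge> l $ 2" "l $ 2 \<ge> l $ 3"
proof -
  define b where "b u v = g (mat 1) (su2_vec u) (su2_vec v)" for u v
  have tan: "su2_vec u \<in> tangent (mat 1)" for u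
    by (simp add: tangent_eq)
  have lin: "g (mat 1) (x *\<^sub>R u + y *\<^sub>R u') v = x * g (mat 1) u v + y * g (mat 1) u' v"
    "g (mat 1) v (x *\<^sub>R u + y *\<^sub>R u') = x * g (mat 1) v u + y * g (mat 1) v u'"
    if "u \<in> tangent (mat 1)" "u' \<in> tangent (mat 1)" "v \<in> tangent (mat 1)" for x y u u' v
    using g SU2_one that unfolding left_invariant_metric_def tensor_field_def by blast+
  have "bilinear b"
    unfolding bilinear_def b_def
    using lin[OF tan tan tan, where x = 1 and y = 1] lin[OF tan tan tan, where y = 0]
    by (auto intro!: linearI simp: linear_add[OF linear_su2_vec] linear_scale[OF linear_su2_vec])
  moreover have "b u v = b v u" for u v
    using g SU2_one tan unfolding left_invariant_metric_def sym_pos_def_def b_def by blast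
  ultimately obtain R l where R: "rotation_matrix R" and sorted: "l $ 1 \<ge> l $ 2" "l $ 2 \<ge> l $ 3"
    and diag: "\<And>u v. b (R *v u) (R *v v) = diag_form l u v"
    using symmetric_form_diagonalization[of b] by blast
  have frame: "su2_frame (\<lambda>v. su2_vec (R *v v))"
    using R by (auto simp: su2_frame_def)
  have "l $ i > 0" for i
  proof -
    have "su2_vec (R *v axis i 1) \<noteq> 0"
      using su2_frame_inj[OF frame, of "axis i 1" 0] linear_0[OF su2_frame_linear[OF frame]]
      by (simp add: axis_eq_0_iff)
    then have "b (R *v axis i 1) (R *v axis i 1) > 0"
      using g SU2_one tan unfolding left_invariant_metric_def sym_pos_def_def b_def by blast
    then show ?thesis
      unfolding diag using exhaust_3[of i] by (auto simp: diag_form_3 axis_def)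
  qed
  then have "framed_metric (\<lambda>v. su2_vec (R *v v)) l g"
    using frame g diag by unfold_locales (auto simp: b_def)
  then show thesis using that sorted by blast
qed

text \<open>The value 0 off the tangent bundle matches the normalisation in \<open>tensor_field\<close>.\<close>

definition diag_metric :: "(real^3 \<Rightarrow> mat2) \<Rightarrow> real^3 \<Rightarrow> tensor02" where
  "diag_metric F l p u v = (if p \<in> SU2 \<and> u \<in> tangent p \<and> v \<in> tangent p
     then diag_form l (inv F (matrix_inv p ** u)) (inv F (matrix_inv p ** v)) else 0)"

lemma framed_diag_metric:
  assumes F: "su2_frame F" and l: "\<And>i. l $ i > 0"
  shows "framed_metric F l (diag_metric F l)"
proof -
  note tan = tangent_frame[OF F]
  have "inj F" using su2_frame_inj[OF F] by (simp add: inj_def)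
  then have val: "diag_metric F l p (p ** F u) (p ** F v) = diag_form l u v" if "p \<in> SU2" for p u v
    using that SU2_inverse(1)[OF that] by (simp add: diag_metric_def tan matrix_mul_assoc)
  have comb: "x *\<^sub>R (p ** F u) + y *\<^sub>R (p ** F u') = p ** F (x *\<^sub>R u + y *\<^sub>R u')" for p :: mat2 and x y u u'
    using su2_frame_linear[OF F]
    by (simp add: linear_add linear_scale matrix_add_ldistrib scaleR_matrix_mult)
  have "tensor_field (diag_metric F l)"
    unfolding tensor_field_def
    by (auto simp: tan comb val diag_form_3 algebra_simps) (auto simp: diag_metric_def tan)
  moreover have "sym_pos_def (diag_metric F l)"
    unfolding sym_pos_def_def
  proof (intro conjI ballI impI)
    show "diag_metric F l p u v = diag_metric F l p v u"
      if "p \<in> SU2" "u \<in> tangent p" "v \<in> tangent p" for p u v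
      using that by (auto simp: tan val diag_form_3)
    fix p u assume p: "p \<in> SU2" and "u \<in> tangent p" and nz: "u \<noteq> 0"
    then obtain w where u: "u = p ** F w" by (auto simp: tan)
    have "w \<noteq> 0"
      using nz u linear_0[OF su2_frame_linear[OF F]] linear_0[OF linear_matrix_mult_left] by metis
    then obtain i where "w $ i \<noteq> 0" by (auto simp: vec_eq_iff)
    then have "w $ i * w $ i > 0" using not_real_square_gt_zero by blast
    then have "0 < (\<Sum>j\<in>UNIV. l $ j * w $ j * w $ j)"
      using l by (intro sum_pos2[of _ i]) (auto simp: mult.assoc less_imp_le)
    then show "diag_metric F l p u u > 0" by (simp add: u val[OF p] diag_form_def)
  qed
  moreover have "left_invariant (diag_metric F l)"
    unfolding left_invariant_def by (auto simp: tan matrix_mul_assoc val SU2_mult)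
  ultimately have "left_invariant_metric (diag_metric F l)" by (simp add: left_invariant_metric_def)
  then show ?thesis
    using F l val[OF SU2_one] by unfold_locales auto
qed

lemma left_invariant_metric_eqI:
  assumes F: "su2_frame F" and h: "tensor_field h" "tensor_field h'"
    and eq: "\<And>p u v. p \<in> SU2 \<Longrightarrow> h p (p ** F u) (p ** F v) = h' p (p ** F u) (p ** F v)"
  shows "h = h'"
proof (intro ext)
  fix p u v
  show "h p u v = h' p u v"
  proof (cases "p \<in> SU2 \<and> u \<in> tangent p \<and> v \<in> tangent p")
    case True
    then show ?thesis using eq by (auto simp: tangent_frame[OF F])
  next
    case False
    then show ?thesis using h unfolding tensor_field_def by metis
  qed
qed

section \<open>Eigenvalues and change of frame\<close>

lemma diag_form_inner: "diag_form l u v = diag_map l u \<bullet> v"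
  by (simp add: diag_form_def diag_map_def inner_vec_def)

lemma diag_form_bounds:
  assumes "l $ 1 \<ge> l $ 2" "l $ 2 \<ge> l $ 3"
  shows "diag_form l u u \<le> l $ 1 * (u \<bullet> u)" "diag_form l u u \<ge> l $ 3 * (u \<bullet> u)"
proof -
  have "diag_form l u u \<le> l $ 1 * u $ 1 * u $ 1 + l $ 1 * u $ 2 * u $ 2 + l $ 1 * u $ 3 * u $ 3"
    unfolding diag_form_3 mult.assoc using assms by (intro add_mono mult_right_mono) auto
  then show "diag_form l u u \<le> l $ 1 * (u \<bullet> u)"
    by (simp add: inner_vec_def sum_3 algebra_simps)
  have "diag_form l u u \<ge> l $ 3 * u $ 1 * u $ 1 + l $ 3 * u $ 2 * u $ 2 + l $ 3 * u $ 3 * u $ 3"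
    unfolding diag_form_3 mult.assoc using assms by (intro add_mono mult_right_mono) auto
  then show "diag_form l u u \<ge> l $ 3 * (u \<bullet> u)"
    by (simp add: inner_vec_def sum_3 algebra_simps)
qed

lemma diag_form_axis: "diag_form l (axis i 1) (axis i 1) = l $ i"
  using exhaust_3[of i] by (auto simp: diag_form_3 axis_def)

text \<open>The supremum is attained at the first and third frame vectors.\<close>

lemma eigenvalue_ratio_sorted:
  assumes "framed_metric F l g" and sorted: "l $ 1 \<ge> l $ 2" "l $ 2 \<ge> l $ 3"
  shows "eigenvalue_ratio g = l $ 1 / l $ 3"
proof -
  interpret framed_metric F l g by fact
  have g0: "g0 (mat 1) (F u) (F v) = u \<bullet> v" for u v
    using g0_frame[OF frame SU2_one, of u v] by simp
  show ?thesis unfolding eigenvalue_ratio_def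
  proof (rule cSup_eq_maximum)
    show "l $ 1 / l $ 3 \<in> {g (mat 1) A A / g (mat 1) B B | A B.
        A \<in> su2 \<and> B \<in> su2 \<and> g0 (mat 1) A A = 1 \<and> g0 (mat 1) B B = 1}"
      using su2_frame_range[OF frame]
      by (intro CollectI exI[of _ "F (axis 1 1)"] exI[of _ "F (axis 3 1)"])
        (auto simp: diagonal diag_form_axis g0 inner_axis_axis)
    fix x assume "x \<in> {g (mat 1) A A / g (mat 1) B B | A B.
        A \<in> su2 \<and> B \<in> su2 \<and> g0 (mat 1) A A = 1 \<and> g0 (mat 1) B B = 1}"
    then obtain u v where x: "x = diag_form l u u / diag_form l v v" and uv: "u \<bullet> u = 1" "v \<bullet> v = 1"
      unfolding su2_frame_range[OF frame, symmetric] by (auto simp: diagonal g0)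
    show "x \<le> l $ 1 / l $ 3"
      unfolding x using diag_form_bounds[OF sorted, of u] diag_form_bounds[OF sorted, of v] uv
        l_pos[of 1] l_pos[of 3] by (intro frac_le) auto
  qed
qed

lemma frame_change:
  assumes "su2_frame F" "su2_frame F'"
  obtains C where "rotation_matrix C" "\<And>v. F' v = F (C *v v)"
proof -
  obtain R R' where R: "rotation_matrix R" "F = (\<lambda>v. su2_vec (R *v v))"
    and R': "rotation_matrix R'" "F' = (\<lambda>v. su2_vec (R' *v v))"
    using assms by (auto simp: su2_frame_def)
  show thesis
  proof (rule that[of "transpose R ** R'"])
    show "rotation_matrix (transpose R ** R')"
      using R(1) R'(1) by (simp add: rotation_matrix_def orthogonal_matrix_mul det_mul)
    show "F' v = F ((transpose R ** R') *v v)" for v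
      using rotation_transpose(1)[OF R(1)] by (simp add: R(2) R'(2) flip: matrix_vector_mul_assoc)
  qed
qed

text \<open>The first and third eigenvalues are the extrema of the quadratic form on the unit sphere, and the
second then follows from the invariance of the trace.\<close>

lemma sorted_eigenvalues_unique:
  assumes C: "rotation_matrix C" and eq: "\<And>u v. diag_form y (C *v u) (C *v v) = diag_form y' u v"
    and y: "y $ 1 \<ge> y $ 2" "y $ 2 \<ge> y $ 3" and y': "y' $ 1 \<ge> y' $ 2" "y' $ 2 \<ge> y' $ 3"
  shows "y = y'"
proof -
  have unit: "(C *v axis i 1) \<bullet> (C *v axis i 1) = 1" "(transpose C *v axis i 1) \<bullet> (transpose C *v axis i 1) = 1" for i
  proof -
    show "(C *v axis i 1) \<bullet> (C *v axis i 1) = 1" by (simp add: rotation_inner[OF C] inner_axis_axis)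
    have "rotation_matrix (transpose C)" using C by (simp add: rotation_matrix_def)
    then show "(transpose C *v axis i 1) \<bullet> (transpose C *v axis i 1) = 1"
      by (simp only: rotation_inner inner_axis_axis) simp
  qed
  have fwd: "diag_form y (C *v axis i 1) (C *v axis i 1) = y' $ i" for i
    by (simp add: eq diag_form_axis)
  have bwd: "diag_form y' (transpose C *v axis i 1) (transpose C *v axis i 1) = y $ i" for i
    unfolding eq[symmetric] rotation_transpose(1)[OF C] by (rule diag_form_axis)
  have "y' $ 1 \<le> y $ 1" "y $ 3 \<le> y' $ 3"
    using diag_form_bounds[OF y, of "C *v axis 1 1"] diag_form_bounds[OF y, of "C *v axis 3 1"]
    by (simp_all add: fwd unit)
  moreover have "y $ 1 \<le> y' $ 1" "y' $ 3 \<le> y $ 3"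
    using diag_form_bounds[OF y', of "transpose C *v axis 1 1"] diag_form_bounds[OF y', of "transpose C *v axis 3 1"]
    unfolding bwd unit by simp_all
  moreover have "y $ 1 + y $ 2 + y $ 3 = y' $ 1 + y' $ 2 + y' $ 3"
  proof -
    have row: "C $ k $ 1 * C $ k $ 1 + C $ k $ 2 * C $ k $ 2 + C $ k $ 3 * C $ k $ 3 = 1" for k
    proof -
      have "(C ** transpose C) $ k $ k = 1"
        using C by (simp add: rotation_matrix_def orthogonal_matrix_def mat_def)
      then show ?thesis by (simp add: matrix_matrix_mult_def transpose_def sum_3)
    qed
    have "y' $ i = y $ 1 * (C $ 1 $ i * C $ 1 $ i) + y $ 2 * (C $ 2 $ i * C $ 2 $ i) + y $ 3 * (C $ 3 $ i * C $ 3 $ i)" for i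
      unfolding fwd[of i, symmetric] by (simp add: diag_form_3 matrix_vector_mult_basis column_def)
    then have "y' $ 1 + y' $ 2 + y' $ 3 =
        y $ 1 * (C $ 1 $ 1 * C $ 1 $ 1 + C $ 1 $ 2 * C $ 1 $ 2 + C $ 1 $ 3 * C $ 1 $ 3)
      + y $ 2 * (C $ 2 $ 1 * C $ 2 $ 1 + C $ 2 $ 2 * C $ 2 $ 2 + C $ 2 $ 3 * C $ 2 $ 3)
      + y $ 3 * (C $ 3 $ 1 * C $ 3 $ 1 + C $ 3 $ 2 * C $ 3 $ 2 + C $ 3 $ 3 * C $ 3 $ 3)"
      by (simp only: distrib_left ac_simps)
    then show ?thesis unfolding row by simp
  qed
  ultimately show ?thesis by (simp add: vec_eq_iff forall_3)
qed

text \<open>Invariance means that \<open>C\<close> commutes with the diagonal map of \<open>y\<close>, so its entries vanish between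
coordinates with different \<open>y\<close>. Whenever \<open>l\<close> is constant on the coordinates with equal \<open>y\<close>, the map \<open>C\<close>
commutes with the diagonal map of \<open>l\<close> as well.\<close>

lemma diag_form_invariant_if_coarser:
  assumes C: "rotation_matrix C" and eq: "\<And>u v. diag_form y (C *v u) (C *v v) = diag_form y u v"
    and coarser: "\<And>i j. y $ i = y $ j \<Longrightarrow> l $ i = l $ j"
  shows "diag_form l (C *v u) (C *v v) = diag_form l u v"
proof -
  have comm: "diag_map y (C *v u) = C *v diag_map y u" for u
  proof -
    have "diag_map y (C *v u) \<bullet> w = (C *v diag_map y u) \<bullet> w" for w
      using eq[of u "transpose C *v w"] rotation_inner[OF C, of "diag_map y u" "transpose C *v w"]
      by (simp only: diag_form_inner rotation_transpose[OF C])
    then show ?thesis by (metis vector_eq_rdot)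
  qed
  have entry: "l $ i * C $ i $ j = C $ i $ j * l $ j" for i j
  proof -
    have "diag_map y (C *v axis j 1) $ i = y $ i * C $ i $ j"
      by (simp add: diag_map_def matrix_vector_mult_basis column_def)
    moreover have "(C *v diag_map y (axis j 1)) $ i = C $ i $ j * y $ j"
    proof -
      have "diag_map y (axis j 1) = y $ j *\<^sub>R axis j 1" by (simp add: diag_map_def axis_def vec_eq_iff)
      then show ?thesis
        by (simp add: matrix_vector_mult_scaleR matrix_vector_mult_basis column_def)
    qed
    ultimately have "y $ i * C $ i $ j = C $ i $ j * y $ j" using comm by metis
    then have "C $ i $ j = 0 \<or> y $ i = y $ j" by auto
    then show ?thesis using coarser[of i j] by auto
  qed
  have "diag_map l (C *v u) = C *v diag_map l u" for u
    by (simp only: diag_map_def matrix_vector_mult_def vec_eq_iff vec_lambda_beta sum_distrib_left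
        mult.assoc[symmetric] entry simp_thms)
  then show ?thesis by (simp add: diag_form_inner rotation_inner[OF C])
qed

section \<open>Existence, uniqueness and pinching\<close>

text \<open>A solution and its prescribed cross curvature share a frame, and by \<open>diagonal_pinching\<close> one ordering
of the frame vectors sorts the eigenvalues of both.\<close>

lemma cross_curvature_framed:
  assumes g: "left_invariant_metric g" and Y: "left_invariant_metric Y" and X: "has_cross_curvature g Y"
  obtains F l where "framed_metric F l g" "framed_metric F (cross_eigenvalues l) Y"
    "l $ 1 \<ge> l $ 2" "l $ 2 \<ge> l $ 3" "cross_eigenvalues l $ 1 \<ge> cross_eigenvalues l $ 2" "cross_eigenvalues l $ 2 \<ge> cross_eigenvalues l $ 3"
proof -
  obtain F l where "framed_metric F l g" and sorted: "l $ 1 \<ge> l $ 2" "l $ 2 \<ge> l $ 3"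
    using framed_metric_exists[OF g] by blast
  then interpret framed_metric F l g by blast
  have diag: "Y (mat 1) (F u) (F v) = diag_form (cross_eigenvalues l) u v" for u v
    using X SU2_one unfolding has_cross_curvature_iff by (metis matrix_mul_lid)
  have pos: "cross_eigenvalues l $ i > 0" for i
  proof -
    have "F (axis i 1) \<noteq> 0"
      using su2_frame_inj[OF frame, of "axis i 1" 0] linear_0[OF F_linear] by (simp add: axis_eq_0_iff)
    moreover have "F (axis i 1) \<in> tangent (mat 1)"
      using frame_tangent[of "mat 1"] by simp
    ultimately have "Y (mat 1) (F (axis i 1)) (F (axis i 1)) > 0"
      using Y SU2_one unfolding left_invariant_metric_def sym_pos_def_def by blast
    then show ?thesis by (simp add: diag diag_form_axis)
  qed
  have "framed_metric F (cross_eigenvalues l) Y"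
    using frame pos Y diag by unfold_locales
  moreover have "cross_eigenvalues l $ 1 \<ge> cross_eigenvalues l $ 2" "cross_eigenvalues l $ 2 \<ge> cross_eigenvalues l $ 3"
    using diagonal_pinching[OF l_pos[of 1] l_pos[of 2] l_pos[of 3]] pos[of 1] pos[of 2] pos[of 3] sorted
    by (simp_all add: cross_eigenvalues_def)
  ultimately show thesis using that framed_metric_axioms sorted by blast
qed

lemma cross_eigenvalues_inj:
  assumes "\<And>i. l $ i > 0" "\<And>i. l' $ i > 0" "\<And>i. cross_eigenvalues l $ i > 0" "cross_eigenvalues l = cross_eigenvalues l'"
  shows "l = l'"
proof -
  have "l $ 1 = l' $ 1 \<and> l $ 2 = l' $ 2 \<and> l $ 3 = l' $ 3"
    by (rule diagonal_uniqueness; (rule assms)?)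
      (use assms(3)[of 1] assms(3)[of 2] assms(3)[of 3] assms(4) in
        \<open>simp_all add: cross_eigenvalues_def vec_eq_iff forall_3\<close>)
  then show ?thesis by (simp add: vec_eq_iff forall_3)
qed

lemma metric_eigenvalues_eq_if_cross_eigenvalues_eq:
  assumes pos: "\<And>i. l $ i > 0" "\<And>i. cross_eigenvalues l $ i > 0" and eq: "cross_eigenvalues l $ i = cross_eigenvalues l $ j"
  shows "l $ i = l $ j"
proof -
  have X: "cross_eigenvalue (l $ 1) (l $ 2) (l $ 3) > 0" "cross_eigenvalue (l $ 2) (l $ 3) (l $ 1) > 0"
    "cross_eigenvalue (l $ 3) (l $ 1) (l $ 2) > 0"
    using pos(2)[of 1] pos(2)[of 2] pos(2)[of 3] by (simp_all add: cross_eigenvalues_def)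
  have "cross_eigenvalues l $ 1 = cross_eigenvalues l $ 2 \<Longrightarrow> l $ 1 = l $ 2"
    "cross_eigenvalues l $ 2 = cross_eigenvalues l $ 3 \<Longrightarrow> l $ 2 = l $ 3"
    "cross_eigenvalues l $ 3 = cross_eigenvalues l $ 1 \<Longrightarrow> l $ 3 = l $ 1"
    using cross_eigenvalue_inj[OF pos(1) pos(1) pos(1) X]
      cross_eigenvalue_inj[OF pos(1) pos(1) pos(1) X(2,3,1)]
      cross_eigenvalue_inj[OF pos(1) pos(1) pos(1) X(3,1,2)]
    by (simp_all add: cross_eigenvalues_def)
  then show ?thesis using eq exhaust_3[of i] exhaust_3[of j] by metis
qed

text \<open>Diagonalise \<open>Y\<close>, solve the equations for its eigenvalues, and take the metric with the resulting
eigenvalues in the same frame.\<close>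

lemma cross_curvature_exists:
  assumes Y: "left_invariant_metric Y"
  shows "\<exists>g. left_invariant_metric g \<and> has_cross_curvature g Y"
proof -
  obtain F y where FY: "framed_metric F y Y" using framed_metric_exists[OF Y] by blast
  then interpret Y: framed_metric F y Y .
  obtain a b c where abc: "a > 0" "b > 0" "c > 0"
    "cross_eigenvalue a b c = y $ 1" "cross_eigenvalue b c a = y $ 2" "cross_eigenvalue c a b = y $ 3"
    "sec_curv a b c > 0" "sec_curv b c a > 0" "sec_curv c a b > 0"
    using diagonal_existence[OF Y.l_pos Y.l_pos Y.l_pos] by metis
  define l :: "real^3" where "l = vector [a, b, c]"
  have "\<forall>i. l $ i > 0" using abc by (simp add: l_def forall_3)
  then interpret g: framed_metric F l "diag_metric F l"
    using framed_diag_metric[OF Y.frame] by blast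
  have "\<forall>i. sec_curv_vec l $ i \<noteq> 0" using abc by (simp add: sec_curv_vec_def l_def forall_3)
  moreover have "cross_eigenvalues l = y" using abc by (simp add: cross_eigenvalues_def l_def forall_3 vec_eq_iff)
  ultimately have "has_cross_curvature (diag_metric F l) Y"
    by (simp add: g.has_cross_curvature_iff Y.metric_frame)
  then show ?thesis using g.metric by blast
qed

text \<open>In sorted frames the eigenvalues of \<open>Y\<close> agree and determine those of both metrics. The frames
themselves differ by a rotation that preserves \<open>Y\<close>, and by
\<open>metric_eigenvalues_eq_if_cross_eigenvalues_eq\<close> such a rotation also preserves the metrics.\<close>

lemma cross_curvature_unique:
  assumes Y: "left_invariant_metric Y" and g: "left_invariant_metric g" "has_cross_curvature g Y"
    and g': "left_invariant_metric g'" "has_cross_curvature g' Y"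
  shows "g = g'"
proof -
  obtain F l where gF: "framed_metric F l g" and YF: "framed_metric F (cross_eigenvalues l) Y"
    and s: "cross_eigenvalues l $ 1 \<ge> cross_eigenvalues l $ 2" "cross_eigenvalues l $ 2 \<ge> cross_eigenvalues l $ 3"
    using cross_curvature_framed[OF g(1) Y g(2)] by metis
  obtain F' l' where gF': "framed_metric F' l' g'" and YF': "framed_metric F' (cross_eigenvalues l') Y"
    and s': "cross_eigenvalues l' $ 1 \<ge> cross_eigenvalues l' $ 2" "cross_eigenvalues l' $ 2 \<ge> cross_eigenvalues l' $ 3"
    using cross_curvature_framed[OF g'(1) Y g'(2)] by metis
  interpret g: framed_metric F l g by fact
  interpret g': framed_metric F' l' g' by fact
  interpret Y: framed_metric F "cross_eigenvalues l" Y by fact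
  interpret Y': framed_metric F' "cross_eigenvalues l'" Y by fact
  obtain C where C: "rotation_matrix C" and F': "\<And>v. F' v = F (C *v v)"
    using frame_change[OF g.frame g'.frame] by blast
  have dy: "diag_form (cross_eigenvalues l) (C *v u) (C *v v) = diag_form (cross_eigenvalues l') u v" for u v
    using Y.diagonal[of "C *v u" "C *v v"] Y'.diagonal[of u v] by (simp add: F')
  then have y: "cross_eigenvalues l = cross_eigenvalues l'"
    using sorted_eigenvalues_unique[OF C _ s s'] by blast
  then have l: "l = l'"
    using cross_eigenvalues_inj[OF g.l_pos g'.l_pos Y.l_pos] by blast
  have dl: "diag_form l (C *v u) (C *v v) = diag_form l u v" for u v
    using diag_form_invariant_if_coarser[OF C, of "cross_eigenvalues l" l] dy y
      metric_eigenvalues_eq_if_cross_eigenvalues_eq[OF g.l_pos Y.l_pos] by metis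
  show ?thesis
  proof (rule left_invariant_metric_eqI[OF g'.frame])
    show "tensor_field g" "tensor_field g'"
      using g g' by (simp_all add: left_invariant_metric_def)
    show "g p (p ** F' u) (p ** F' v) = g' p (p ** F' u) (p ** F' v)" if "p \<in> SU2" for p u v
      using that dl g'.metric_frame[OF that] g.metric_frame[OF that] by (simp add: F' l)
  qed
qed

lemma framed_metric_round_iff:
  assumes "framed_metric F l g" "l $ 1 \<ge> l $ 2" "l $ 2 \<ge> l $ 3"
  shows "l $ 1 = l $ 3 \<longleftrightarrow> (\<exists>\<rho>>0. g = (\<lambda>p u v. \<rho> * g0 p u v))"
proof
  interpret framed_metric F l g by fact
  assume "l $ 1 = l $ 3"
  then have l: "l = (\<chi> i. l $ 1)" using assms(2,3) by (simp add: vec_eq_iff forall_3)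
  have "g = (\<lambda>p u v. l $ 1 * g0 p u v)"
  proof (intro ext)
    fix p u v
    show "g p u v = l $ 1 * g0 p u v"
    proof (cases "p \<in> SU2 \<and> u \<in> tangent p \<and> v \<in> tangent p")
      case True
      then obtain x y where uv: "u = p ** F x" "v = p ** F y" by (auto simp: tangent)
      have "diag_form l x y = l $ 1 * (x \<bullet> y)"
        by (subst l) (simp add: diag_form_3 inner_vec_def sum_3 algebra_simps)
      then show ?thesis using True by (simp add: uv metric_frame g0_frame[OF frame])
    next
      case False
      then have "g p u v = 0" using metric unfolding left_invariant_metric_def tensor_field_def by metis
      then show ?thesis using False by (auto simp: g0_def)
    qed
  qed
  then show "\<exists>\<rho>>0. g = (\<lambda>p u v. \<rho> * g0 p u v)" using l_pos by blast
next
  interpret framed_metric F l g by fact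
  assume "\<exists>\<rho>>0. g = (\<lambda>p u v. \<rho> * g0 p u v)"
  then obtain \<rho> where g: "g = (\<lambda>p u v. \<rho> * g0 p u v)" by blast
  have "l $ i = \<rho>" for i
    using diagonal[of "axis i 1" "axis i 1"] g0_frame[OF frame SU2_one, of "axis i 1" "axis i 1"]
    unfolding diag_form_axis by (simp add: g inner_axis_axis)
  then show "l $ 1 = l $ 3" by simp
qed

theorem theorem8p1:
  fixes Y :: tensor02
  assumes "left_invariant_metric Y"
  shows "(\<exists>!g. left_invariant_metric g \<and> has_cross_curvature g Y) \<and>
    (\<forall>g. left_invariant_metric g \<and> has_cross_curvature g Y \<longrightarrow>
       eigenvalue_ratio g \<le> eigenvalue_ratio Y \<and>
       (eigenvalue_ratio g = eigenvalue_ratio Y \<longleftrightarrow> (\<exists>\<rho>>0. g = (\<lambda>p u v. \<rho> * g0 p u v))))"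
proof (intro conjI allI impI)
  show "\<exists>!g. left_invariant_metric g \<and> has_cross_curvature g Y"
    using cross_curvature_exists[OF assms] cross_curvature_unique[OF assms] by blast
next
  fix g assume "left_invariant_metric g \<and> has_cross_curvature g Y"
  then obtain F l where gF: "framed_metric F l g" and YF: "framed_metric F (cross_eigenvalues l) Y"
    and s: "l $ 1 \<ge> l $ 2" "l $ 2 \<ge> l $ 3"
    and sY: "cross_eigenvalues l $ 1 \<ge> cross_eigenvalues l $ 2" "cross_eigenvalues l $ 2 \<ge> cross_eigenvalues l $ 3"
    using cross_curvature_framed[of g Y] assms by metis
  note pos = framed_metric.l_pos[OF gF] and posY = framed_metric.l_pos[OF YF]
  have "cross_eigenvalue (l $ 1) (l $ 2) (l $ 3) > 0" "cross_eigenvalue (l $ 2) (l $ 3) (l $ 1) > 0"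
    "cross_eigenvalue (l $ 3) (l $ 1) (l $ 2) > 0"
    using posY[of 1] posY[of 2] posY[of 3] by (simp_all add: cross_eigenvalues_def)
  note pinching = diagonal_pinching(3,4)[OF pos pos pos this s]
  have ratios: "eigenvalue_ratio g = l $ 1 / l $ 3"
    "eigenvalue_ratio Y = cross_eigenvalue (l $ 1) (l $ 2) (l $ 3) / cross_eigenvalue (l $ 3) (l $ 1) (l $ 2)"
    using eigenvalue_ratio_sorted[OF gF s] eigenvalue_ratio_sorted[OF YF sY] by (simp_all add: cross_eigenvalues_def)
  show "eigenvalue_ratio g \<le> eigenvalue_ratio Y"
    unfolding ratios by (rule pinching)
  show "eigenvalue_ratio g = eigenvalue_ratio Y \<longleftrightarrow> (\<exists>\<rho>>0. g = (\<lambda>p u v. \<rho> * g0 p u v))"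
    unfolding ratios pinching(2) by (rule framed_metric_round_iff[OF gF s])
qed

end
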